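(* The LP problems with gainfree Leontief substitution systems, i.e. problems of the form minimize $\mathbf{c}^T\mathbf{x}$ subject to $A\mathbf{x} = \mathbf{b}$, $\mathbf{x} \in \mathbb{R}^n_+$, admit a combinatorial ${\rm O}(m^3n)$-time certifying algorithm.
   Context: $A \in \mathbb{R}^{m\times n}$ is Leontief: each column has at most one positive entry, and these positive entries are assumed to equal one (obtainable by scaling variables). Also $\mathbf{b} \ge \mathbf{0}$ and $\mathbf{c} \in \mathbb{R}^n$. Gainfreeness is defined through a hypergraph. There is a vertex $v_i$ for each row $i$. There is a hyperarc $E_j$ for each column $j$, with head $h(E_j)=v_i$ if $A_{ij}=1$ (empty head if the column has no positive entry) and tail $T(E_j)=\{v_i : A_{ij}<0\}$. Each tail element carries the weight $\gamma(E_j,v_i)=-A_{ij}>0$. A directed cycle is a sequence $v_1E_1v_2\dots E_kv_{k+1}$ with $v_1=v_{k+1}$, no repeated intermediate vertex or hyperarc, $v_{i+1}=h(E_i)$ and $v_i\in T(E_i)$. Its gain is $1/\prod_{i=1}^k\gamma(E_i,v_i)$. The system is gainfree if every directed cycle has gain at most one. The dual problem is maximize $\mathbf{y}^T\mathbf{b}$ subject to $\mathbf{y}^TA\le\mathbf{c}^T$, $\mathbf{y}\in\mathbb{R}^m$. A certifying algorithm outputs, according to which case holds: (i) primal and dual feasible solutions with equal objective values; (ii) a Farkas certificate of primal infeasibility ($\mathbf{z}^TA\le\mathbf{0}$, $\mathbf{z}^T\mathbf{b}>0$) together with a dual feasible solution; (iii) a primal feasible solution together with a Farkas certificate of dual infeasibility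 ($A\mathbf{r}=\mathbf{0}$, $\mathbf{c}^T\mathbf{r}<0$, $\mathbf{r}\ge\mathbf{0}$); (iv) both Farkas certificates. Combinatorial means using only additions, subtractions, multiplications and comparisons.
   Formalization: The dual feasible solution y is output as numerators over one common positive denominator, since without division y itself cannot be computed in bounded time (A=(-g), b=0, c=-1 forces y ≥ 1/g); m, n ≥ 1 is assumed. *)

theory Defs
  imports Complex_Main "Jordan_Normal_Form.Matrix"
begin

section \<open>Gainfree Leontief systems\<close>

text \<open>Rows and columns are indexed from 0, so the vertices of the hypergraph of \<open>A\<close> are the numbers
  below \<open>dim_row A\<close> and its hyperarcs the numbers below \<open>dim_col A\<close>.\<close>

definition leontief :: "real mat \<Rightarrow> bool" where
  "leontief A \<longleftrightarrow>
     (\<forall>j < dim_col A. card {i. i < dim_row A \<and> A $$ (i, j) > 0} \<le> 1) \<and>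
     (\<forall>i < dim_row A. \<forall>j < dim_col A. A $$ (i, j) > 0 \<longrightarrow> A $$ (i, j) = 1)"

definition head :: "real mat \<Rightarrow> nat \<Rightarrow> nat option" where
  "head A j = (if \<exists>i < dim_row A. A $$ (i, j) = 1
               then Some (THE i. i < dim_row A \<and> A $$ (i, j) = 1) else None)"

definition tail :: "real mat \<Rightarrow> nat \<Rightarrow> nat set" where
  "tail A j = {i. i < dim_row A \<and> A $$ (i, j) < 0}"

definition weight :: "real mat \<Rightarrow> nat \<Rightarrow> nat \<Rightarrow> real" where
  "weight A j i = - A $$ (i, j)"

text \<open>The cycle \<open>v\<^sub>1 E\<^sub>1 v\<^sub>2 \<dots> E\<^sub>k v\<^sub>k\<^sub>+\<^sub>1\<close> is given by its \<open>k + 1\<close> vertices and its \<open>k\<close> hyperarcs.\<close>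

definition directed_cycle :: "real mat \<Rightarrow> nat list \<Rightarrow> nat list \<Rightarrow> bool" where
  "directed_cycle A vs es \<longleftrightarrow>
     es \<noteq> [] \<and> length vs = Suc (length es) \<and>
     set vs \<subseteq> {..<dim_row A} \<and> set es \<subseteq> {..<dim_col A} \<and>
     hd vs = last vs \<and> distinct (butlast vs) \<and> distinct es \<and>
     (\<forall>i < length es. vs ! i \<in> tail A (es ! i) \<and> head A (es ! i) = Some (vs ! Suc i))"

definition gain :: "real mat \<Rightarrow> nat list \<Rightarrow> nat list \<Rightarrow> real" where
  "gain A vs es = 1 / (\<Prod>i < length es. weight A (es ! i) (vs ! i))"

definition gainfree :: "real mat \<Rightarrow> bool" where
  "gainfree A \<longleftrightarrow> (\<forall>vs es. directed_cycle A vs es \<longrightarrow> gain A vs es \<le> 1)"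


section \<open>Feasible solutions and certificates\<close>

text \<open>The order on vectors is componentwise and includes equality of dimensions.\<close>

definition primal_feasible :: "real mat \<Rightarrow> real vec \<Rightarrow> real vec \<Rightarrow> bool" where
  "primal_feasible A b x \<longleftrightarrow> 0\<^sub>v (dim_col A) \<le> x \<and> A *\<^sub>v x = b"

definition dual_feasible :: "real mat \<Rightarrow> real vec \<Rightarrow> real vec \<Rightarrow> bool" where
  "dual_feasible A c y \<longleftrightarrow> y \<in> carrier_vec (dim_row A) \<and> A\<^sup>T *\<^sub>v y \<le> c"

definition primal_farkas :: "real mat \<Rightarrow> real vec \<Rightarrow> real vec \<Rightarrow> bool" where
  "primal_farkas A b z \<longleftrightarrow>
     z \<in> carrier_vec (dim_row A) \<and> A\<^sup>T *\<^sub>v z \<le> 0\<^sub>v (dim_col A) \<and> z \<bullet> b > 0"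

definition dual_farkas :: "real mat \<Rightarrow> real vec \<Rightarrow> real vec \<Rightarrow> bool" where
  "dual_farkas A c r \<longleftrightarrow>
     0\<^sub>v (dim_col A) \<le> r \<and> A *\<^sub>v r = 0\<^sub>v (dim_row A) \<and> c \<bullet> r < 0"

datatype certificate =
    Optimal "real vec" "real vec"
  | Primal_Infeasible "real vec" "real vec"
  | Dual_Infeasible "real vec" "real vec"
  | Both_Infeasible "real vec" "real vec"

fun valid_certificate :: "real mat \<Rightarrow> real vec \<Rightarrow> real vec \<Rightarrow> certificate \<Rightarrow> bool" where
  "valid_certificate A b c (Optimal x y) \<longleftrightarrow>
     primal_feasible A b x \<and> dual_feasible A c y \<and> c \<bullet> x = y \<bullet> b"
| "valid_certificate A b c (Primal_Infeasible z y) \<longleftrightarrow>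
     primal_farkas A b z \<and> dual_feasible A c y"
| "valid_certificate A b c (Dual_Infeasible x r) \<longleftrightarrow>
     primal_feasible A b x \<and> dual_farkas A c r"
| "valid_certificate A b c (Both_Infeasible z r) \<longleftrightarrow>
     primal_farkas A b z \<and> dual_farkas A c r"


section \<open>Combinatorial algorithms\<close>

text \<open>A uniform real RAM, presented as a while language. Real numbers live in named two-dimensional
  arrays and are only added, subtracted, multiplied and compared. Indices are natural numbers, kept
  in named registers and one-dimensional arrays, and are only added, subtracted and compared. There
  is no conversion between the two sorts, and the only constants are integers. As
  \<open>Not\<close> and \<open>And\<close> are available, the single comparison \<open><\<close> gives all the others.\<close>

type_synonym vname = string

datatype iexp =
    IConst nat
  | IVar vname
  | IArr vname iexp
  | IPlus iexp iexp
  | IMinus iexp iexp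

datatype rexp =
    RConst int
  | RArr vname iexp iexp
  | RPlus rexp rexp
  | RMinus rexp rexp
  | RTimes rexp rexp

datatype bexp =
    ILess iexp iexp
  | RLess rexp rexp
  | Not bexp
  | And bexp bexp

datatype com =
    Skip
  | IAssign vname iexp
  | IStore vname iexp iexp
  | RStore vname iexp iexp rexp
  | Seq com com
  | If bexp com com
  | While bexp com

record state =
  ivar :: "vname \<Rightarrow> nat"
  iarr :: "vname \<Rightarrow> nat \<Rightarrow> nat"
  rarr :: "vname \<Rightarrow> nat \<Rightarrow> nat \<Rightarrow> real"

fun ival :: "iexp \<Rightarrow> state \<Rightarrow> nat" where
  "ival (IConst k) s = k"
| "ival (IVar v) s = ivar s v"
| "ival (IArr a e) s = iarr s a (ival e s)"
| "ival (IPlus e f) s = ival e s + ival f s"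
| "ival (IMinus e f) s = ival e s - ival f s"

fun rval :: "rexp \<Rightarrow> state \<Rightarrow> real" where
  "rval (RConst k) s = of_int k"
| "rval (RArr a e f) s = rarr s a (ival e s) (ival f s)"
| "rval (RPlus e f) s = rval e s + rval f s"
| "rval (RMinus e f) s = rval e s - rval f s"
| "rval (RTimes e f) s = rval e s * rval f s"

fun bval :: "bexp \<Rightarrow> state \<Rightarrow> bool" where
  "bval (ILess e f) s \<longleftrightarrow> ival e s < ival f s"
| "bval (RLess e f) s \<longleftrightarrow> rval e s < rval f s"
| "bval (Not p) s \<longleftrightarrow> \<not> bval p s"
| "bval (And p q) s \<longleftrightarrow> bval p s \<and> bval q s"

text \<open>Every node of an expression, that is every constant, memory access, arithmetic operation,
  comparison and connective, takes one unit of time.\<close>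

fun icost :: "iexp \<Rightarrow> nat" where
  "icost (IConst k) = 1"
| "icost (IVar v) = 1"
| "icost (IArr a e) = 1 + icost e"
| "icost (IPlus e f) = 1 + icost e + icost f"
| "icost (IMinus e f) = 1 + icost e + icost f"

fun rcost :: "rexp \<Rightarrow> nat" where
  "rcost (RConst k) = 1"
| "rcost (RArr a e f) = 1 + icost e + icost f"
| "rcost (RPlus e f) = 1 + rcost e + rcost f"
| "rcost (RMinus e f) = 1 + rcost e + rcost f"
| "rcost (RTimes e f) = 1 + rcost e + rcost f"

fun bcost :: "bexp \<Rightarrow> nat" where
  "bcost (ILess e f) = 1 + icost e + icost f"
| "bcost (RLess e f) = 1 + rcost e + rcost f"
| "bcost (Not p) = 1 + bcost p"
| "bcost (And p q) = 1 + bcost p + bcost q"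

text \<open>\<open>exec p s t s'\<close>: started in \<open>s\<close>, the program \<open>p\<close> halts in \<open>s'\<close> after exactly \<open>t\<close> units of
  time.\<close>

inductive exec :: "com \<Rightarrow> state \<Rightarrow> nat \<Rightarrow> state \<Rightarrow> bool" where
  Skip: "exec Skip s 1 s"
| IAssign: "exec (IAssign v e) s (1 + icost e) (s\<lparr>ivar := (ivar s)(v := ival e s)\<rparr>)"
| IStore: "exec (IStore a e f) s (1 + icost e + icost f)
    (s\<lparr>iarr := (iarr s)(a := (iarr s a)(ival e s := ival f s))\<rparr>)"
| RStore: "exec (RStore a e f g) s (1 + icost e + icost f + rcost g)
    (s\<lparr>rarr := (rarr s)(a := (rarr s a)(ival e s := (rarr s a (ival e s))(ival f s := rval g s)))\<rparr>)"
| Seq: "exec p s t s' \<Longrightarrow> exec q s' u s'' \<Longrightarrow> exec (Seq p q) s (1 + t + u) s''"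
| IfTrue: "bval e s \<Longrightarrow> exec p s t s' \<Longrightarrow> exec (If e p q) s (1 + bcost e + t) s'"
| IfFalse: "\<not> bval e s \<Longrightarrow> exec q s t s' \<Longrightarrow> exec (If e p q) s (1 + bcost e + t) s'"
| WhileFalse: "\<not> bval e s \<Longrightarrow> exec (While e p) s (1 + bcost e) s"
| WhileTrue: "bval e s \<Longrightarrow> exec p s t s' \<Longrightarrow> exec (While e p) s' u s'' \<Longrightarrow>
    exec (While e p) s (1 + bcost e + t + u) s''"

lemma exec_deterministic:
  "exec p s t s' \<Longrightarrow> exec p s u s'' \<Longrightarrow> t = u \<and> s' = s''"
proof (induction arbitrary: u s'' rule: exec.induct)
  case (Seq p s t s1 q u1 s2)
  from Seq.prems show ?case by cases (use Seq.IH in blast)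
next
  case (IfTrue e s p t s1 q)
  from IfTrue.prems show ?case by cases (use IfTrue in blast)+
next
  case (IfFalse e s q t s1 p)
  from IfFalse.prems show ?case by cases (use IfFalse in blast)+
next
  case (WhileTrue e s p t s1 u1 s2)
  from WhileTrue.prems show ?case by cases (use WhileTrue in blast)+
qed (auto elim: exec.cases)

text \<open>The input \<open>m\<close>, \<open>n\<close>, \<open>A\<close>, \<open>b\<close>, \<open>c\<close>, with the vectors stored as columns; all other memory is 0.\<close>

definition input_state :: "real mat \<Rightarrow> real vec \<Rightarrow> real vec \<Rightarrow> state" where
  "input_state A b c =
     \<lparr>ivar = (\<lambda>_. 0)(''m'' := dim_row A, ''n'' := dim_col A),
      iarr = (\<lambda>_ _. 0),
      rarr = (\<lambda>_ _ _. 0)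
        (''A'' := (\<lambda>i j. if i < dim_row A \<and> j < dim_col A then A $$ (i, j) else 0),
         ''b'' := (\<lambda>i j. if i < dim_vec b \<and> j = 0 then b $ i else 0),
         ''c'' := (\<lambda>i j. if i < dim_vec c \<and> j = 0 then c $ i else 0))\<rparr>"

definition stored_vec :: "state \<Rightarrow> vname \<Rightarrow> nat \<Rightarrow> real vec" where
  "stored_vec s a k = vec k (\<lambda>i. rarr s a i 0)"

text \<open>The output is read off the final state, the register \<open>''case''\<close> telling which of the four
  certificates it is. The vectors \<open>x\<close>, \<open>z\<close>, \<open>r\<close> are stored as they are. A dual feasible \<open>y\<close> is
  stored as numerators \<open>''y''\<close> over one common positive denominator \<open>''d''\<close>. This is
  forced by the absence of division: for \<open>m = n = 1\<close>, \<open>A = (-g)\<close> with \<open>g > 0\<close>, \<open>b = 0\<close>, \<open>c = -1\<close>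
  the only valid certificates have \<open>y \<ge> 1 / g\<close>, which no bounded number of additions,
  subtractions, multiplications and comparisons can achieve for all \<open>g\<close>.\<close>

fun outputs :: "nat \<Rightarrow> nat \<Rightarrow> state \<Rightarrow> certificate \<Rightarrow> bool" where
  "outputs m n s (Optimal x y) \<longleftrightarrow> ivar s ''case'' = 1 \<and>
     x = stored_vec s ''x'' n \<and>
     rarr s ''d'' 0 0 > 0 \<and> y = (1 / rarr s ''d'' 0 0) \<cdot>\<^sub>v stored_vec s ''y'' m"
| "outputs m n s (Primal_Infeasible z y) \<longleftrightarrow> ivar s ''case'' = 2 \<and>
     z = stored_vec s ''z'' m \<and>
     rarr s ''d'' 0 0 > 0 \<and> y = (1 / rarr s ''d'' 0 0) \<cdot>\<^sub>v stored_vec s ''y'' m"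
| "outputs m n s (Dual_Infeasible x r) \<longleftrightarrow> ivar s ''case'' = 3 \<and>
     x = stored_vec s ''x'' n \<and> r = stored_vec s ''r'' n"
| "outputs m n s (Both_Infeasible z r) \<longleftrightarrow> ivar s ''case'' = 4 \<and>
     z = stored_vec s ''z'' m \<and> r = stored_vec s ''r'' n"

end

theory Submission
  imports Defs
begin

text \<open>Gainfreeness makes value iteration on the dual constraints
  \<open>y\<^sub>h \<le> c\<^sub>j + \<Sum> \<gamma>\<^sub>t y\<^sub>t\<close> behave like the Bellman-Ford algorithm. Every vertex starts at a symbolic
  infinitely large value, so that values are pairs compared lexicographically, and a root of value 0
  is the head of the columns without positive entry. Each value is the cost of an explicit
  flow \<open>X\<close> that meets a unit demand up to a leftover whose size is the leading coefficient \<open>B\<close> of the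
  value. After \<open>m + 1\<close> rounds \<open>B\<close> is stable and satisfies \<open>B\<^sup>T A \<le> 0\<close>; it is either a Farkas certificate
  or, if \<open>B\<^sup>T b = 0\<close>, the flows for the demand \<open>b\<close> have no leftover and form a primal solution.
  If the values are stable, they are dual feasible and optimal. Otherwise a
  chain of strict decreases leads through all levels and visits a vertex twice. The closed walk in
  between has weight at least one, so the later flow at this vertex dominates the earlier one, and
  their difference is a ray of negative cost. No division is needed for it.\<close>


section \<open>Programs with bounded loops\<close>

text \<open>The gain of a cycle is the reciprocal of its product of weights, so gainfreeness bounds
  these products from below by one. Hence flows cannot shrink from one visit of a vertex to a visit
  on a higher level, whereas values can only fall from level to level. The stability of
  \<open>B\<close> and the ray both come from this opposition. It needs two visits of one vertex,
  and a chain with m + 1 positions among m rows must contain them: this is the origin of the m + 1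
  rounds. The obstacle for a ray is that a circulation computed from the cycle alone would be the
  solution of a linear system. Storing the flows of all levels replaces this by a subtraction. The
  price is about (m + 1)^2 rows with n entries, each a sum over at most m tail elements, and this is
  the bound m^3 n. A numerical start value would have to exceed a bound that is unknown in advance.
  The symbolic one is replaced by a number only at the end, when the constraints that bound it from
  below are known; that number is a fraction, whose numerator and denominator are kept
  apart.\<close>

datatype prog =
    PSkip
  | PI vname iexp
  | PA vname iexp iexp
  | PR vname iexp iexp rexp
  | PSeq prog prog (infixr ";;" 60)
  | PIf bexp prog prog
  | PFor vname vname prog

definition set_reg :: "vname \<Rightarrow> nat \<Rightarrow> state \<Rightarrow> state" where
  "set_reg v k s = s\<lparr>ivar := (ivar s)(v := k)\<rparr>"

definition step :: "vname \<Rightarrow> (state \<Rightarrow> state) \<Rightarrow> state \<Rightarrow> state" where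
  "step i f s = set_reg i (Suc (ivar (f s) i)) (f s)"

text \<open>All loops are counting loops, so every program halts and its meaning is a total
  function. Correctness is proved for this function, and \<open>exec_compile\<close> carries it over
  to the while language. The bound of a loop is read only once.\<close>

primrec sem :: "prog \<Rightarrow> state \<Rightarrow> state" where
  "sem PSkip = (\<lambda>s. s)"
| "sem (PI v e) = (\<lambda>s. set_reg v (ival e s) s)"
| "sem (PA a e f) = (\<lambda>s. s\<lparr>iarr := (iarr s)(a := (iarr s a)(ival e s := ival f s))\<rparr>)"
| "sem (PR a e f g) = (\<lambda>s. s\<lparr>rarr := (rarr s)(a := (rarr s a)(ival e s :=
      (rarr s a (ival e s))(ival f s := rval g s)))\<rparr>)"
| "sem (PSeq p q) = (\<lambda>s. sem q (sem p s))"
| "sem (PIf e p q) = (\<lambda>s. if bval e s then sem p s else sem q s)"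
| "sem (PFor i N p) = (\<lambda>s. (step i (sem p) ^^ ivar s N) (set_reg i 0 s))"

primrec compile :: "prog \<Rightarrow> com" where
  "compile PSkip = Skip"
| "compile (PI v e) = IAssign v e"
| "compile (PA a e f) = IStore a e f"
| "compile (PR a e f g) = RStore a e f g"
| "compile (PSeq p q) = Seq (compile p) (compile q)"
| "compile (PIf e p q) = If e (compile p) (compile q)"
| "compile (PFor i N p) = Seq (IAssign i (IConst 0))
     (While (ILess (IVar i) (IVar N)) (Seq (compile p) (IAssign i (IPlus (IVar i) (IConst 1)))))"

primrec regs :: "prog \<Rightarrow> vname set" where
  "regs PSkip = {}"
| "regs (PI v e) = {v}"
| "regs (PA a e f) = {}"
| "regs (PR a e f g) = {}"
| "regs (PSeq p q) = regs p \<union> regs q"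
| "regs (PIf e p q) = regs p \<union> regs q"
| "regs (PFor i N p) = insert i (regs p)"

primrec iarrs :: "prog \<Rightarrow> vname set" where
  "iarrs PSkip = {}"
| "iarrs (PI v e) = {}"
| "iarrs (PA a e f) = {a}"
| "iarrs (PR a e f g) = {}"
| "iarrs (PSeq p q) = iarrs p \<union> iarrs q"
| "iarrs (PIf e p q) = iarrs p \<union> iarrs q"
| "iarrs (PFor i N p) = iarrs p"

primrec rarrs :: "prog \<Rightarrow> vname set" where
  "rarrs PSkip = {}"
| "rarrs (PI v e) = {}"
| "rarrs (PA a e f) = {}"
| "rarrs (PR a e f g) = {a}"
| "rarrs (PSeq p q) = rarrs p \<union> rarrs q"
| "rarrs (PIf e p q) = rarrs p \<union> rarrs q"
| "rarrs (PFor i N p) = rarrs p"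

definition frame :: "prog \<Rightarrow> state \<Rightarrow> state \<Rightarrow> bool" where
  "frame p s t \<longleftrightarrow> (\<forall>v. v \<notin> regs p \<longrightarrow> ivar t v = ivar s v) \<and>
     (\<forall>a. a \<notin> iarrs p \<longrightarrow> iarr t a = iarr s a) \<and> (\<forall>a. a \<notin> rarrs p \<longrightarrow> rarr t a = rarr s a)"

lemma set_reg_simps [simp]:
  "ivar (set_reg v k s) = (ivar s)(v := k)"
  "iarr (set_reg v k s) = iarr s" "rarr (set_reg v k s) = rarr s"
  by (simp_all add: set_reg_def)

lemma frame_sem: "frame p s (sem p s)"
proof (induction p arbitrary: s)
  case (PFor i N p)
  have "frame (PFor i N p) s ((step i (sem p) ^^ k) (set_reg i 0 s))" for k
  proof (induction k)
    case (Suc k)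
    let ?t = "(step i (sem p) ^^ k) (set_reg i 0 s)"
    have "frame p ?t (sem p ?t)" by (rule PFor.IH)
    then have "frame (PFor i N p) ?t (step i (sem p) ?t)" by (simp add: frame_def step_def)
    with Suc have "frame (PFor i N p) s (step i (sem p) ?t)" by (simp add: frame_def)
    then show ?case by simp
  qed (simp add: frame_def)
  then show ?case by simp
qed (auto simp: frame_def)

lemma
  shows ivar_sem: "v \<notin> regs p \<Longrightarrow> ivar (sem p s) v = ivar s v"
    and iarr_sem: "a \<notin> iarrs p \<Longrightarrow> iarr (sem p s) a = iarr s a"
    and rarr_sem: "a \<notin> rarrs p \<Longrightarrow> rarr (sem p s) a = rarr s a"
  using frame_sem[of p s] by (auto simp: frame_def)

lemma
  assumes "frame p s t"
  shows ivar_frame: "v \<notin> regs p \<Longrightarrow> ivar t v = ivar s v"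
    and iarr_frame: "a \<notin> iarrs p \<Longrightarrow> iarr t a = iarr s a"
    and rarr_frame: "a \<notin> rarrs p \<Longrightarrow> rarr t a = rarr s a"
  using assms by (auto simp: frame_def)

text \<open>Invariant rule. In every step the value of the counter and the preservation of all
  memory that the loop does not write are supplied as premises, so an invariant has to mention only
  what changes.\<close>

lemma sem_For:
  assumes i: "i \<notin> regs p" and K: "ivar s N = K"
    and base: "I 0 (set_reg i 0 s)"
    and step: "\<And>k t. k < K \<Longrightarrow> ivar t i = k \<Longrightarrow> frame (PFor i N p) s t \<Longrightarrow> I k t \<Longrightarrow>
      I (Suc k) (set_reg i (Suc k) (sem p t))"
  shows "I K (sem (PFor i N p) s)"
proof -
  have "k \<le> K \<longrightarrow> (let t = (step i (sem p) ^^ k) (set_reg i 0 s) in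
      ivar t i = k \<and> frame (PFor i N p) s t \<and> I k t)" for k
  proof (induction k)
    case 0
    then show ?case using base by (simp add: frame_def)
  next
    case (Suc k)
    let ?t = "(step i (sem p) ^^ k) (set_reg i 0 s)"
    show ?case
    proof
      assume k: "Suc k \<le> K"
      with Suc have t: "ivar ?t i = k" "frame (PFor i N p) s ?t" "I k ?t"
        by (auto simp: Let_def)
      have "I (Suc k) (set_reg i (Suc k) (sem p ?t))" using k t step by simp
      moreover have "frame (PFor i N p) s (set_reg i (Suc k) (sem p ?t))"
        using t(2) frame_sem[of p ?t] by (simp add: frame_def)
      ultimately show "let t = (step i (sem p) ^^ Suc k) (set_reg i 0 s) in
          ivar t i = Suc k \<and> frame (PFor i N p) s t \<and> I (Suc k) t"
        using t(1) ivar_sem[OF i] by (simp add: step_def)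
    qed
  qed
  from this[of K] K show ?thesis by (simp add: Let_def)
qed

section \<open>Running time of programs with bounded loops\<close>

primrec bounds :: "prog \<Rightarrow> vname set" where
  "bounds PSkip = {}"
| "bounds (PI v e) = {}"
| "bounds (PA a e f) = {}"
| "bounds (PR a e f g) = {}"
| "bounds (PSeq p q) = bounds p \<union> bounds q"
| "bounds (PIf e p q) = bounds p \<union> bounds q"
| "bounds (PFor i N p) = insert N (bounds p)"

primrec fresh_counters :: "prog \<Rightarrow> bool" where
  "fresh_counters PSkip \<longleftrightarrow> True"
| "fresh_counters (PI v e) \<longleftrightarrow> True"
| "fresh_counters (PA a e f) \<longleftrightarrow> True"
| "fresh_counters (PR a e f g) \<longleftrightarrow> True"
| "fresh_counters (PSeq p q) \<longleftrightarrow> fresh_counters p \<and> fresh_counters q"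
| "fresh_counters (PIf e p q) \<longleftrightarrow> fresh_counters p \<and> fresh_counters q"
| "fresh_counters (PFor i N p) \<longleftrightarrow> fresh_counters p \<and> i \<notin> regs p"

text \<open>An upper bound: a conditional is charged for both branches. In a loop, 7 pays for
  resetting the counter (2), the sequencing (1) and the failing test (4), and the 9 of each
  iteration for the test (4), the sequencing (1) and the increment (4).\<close>

primrec time :: "prog \<Rightarrow> (vname \<Rightarrow> nat) \<Rightarrow> nat" where
  "time PSkip = (\<lambda>\<rho>. 1)"
| "time (PI v e) = (\<lambda>\<rho>. 1 + icost e)"
| "time (PA a e f) = (\<lambda>\<rho>. 1 + icost e + icost f)"
| "time (PR a e f g) = (\<lambda>\<rho>. 1 + icost e + icost f + rcost g)"
| "time (PSeq p q) = (\<lambda>\<rho>. 1 + time p \<rho> + time q \<rho>)"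
| "time (PIf e p q) = (\<lambda>\<rho>. 1 + bcost e + time p \<rho> + time q \<rho>)"
| "time (PFor i N p) = (\<lambda>\<rho>. 7 + \<rho> N * (time p \<rho> + 9))"

lemma exec_While_counter:
  assumes body: "\<And>s. (\<And>v. v \<in> V \<Longrightarrow> ivar s v = \<rho> v) \<Longrightarrow> \<exists>t\<le>T. exec (compile p) s t (sem p s)"
    and i: "i \<notin> regs p" and V: "V \<inter> insert i (regs p) = {}" "N \<in> V"
    and s: "\<And>v. v \<in> V \<Longrightarrow> ivar s v = \<rho> v"
  shows "\<exists>t \<le> 4 + (ivar s N - ivar s i) * (T + 9).
    exec (While (ILess (IVar i) (IVar N)) (Seq (compile p) (IAssign i (IPlus (IVar i) (IConst 1)))))
      s t ((step i (sem p) ^^ (ivar s N - ivar s i)) s)"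
  using s
proof (induction r \<equiv> "ivar s N - ivar s i" arbitrary: s)
  case 0
  then have "\<not> bval (ILess (IVar i) (IVar N)) s" by simp
  from exec.WhileFalse[OF this] 0(1)[symmetric] show ?case by (intro exI[of _ 4]) (simp add: numeral_eq_Suc)
next
  case (Suc r)
  let ?b = "ILess (IVar i) (IVar N)" and ?inc = "IAssign i (IPlus (IVar i) (IConst 1))"
  let ?s = "step i (sem p) s"
  from body Suc.prems obtain t where t: "t \<le> T" "exec (compile p) s t (sem p s)" by blast
  have "exec ?inc (sem p s) 4 ?s"
    using exec.IAssign[of i "IPlus (IVar i) (IConst 1)" "sem p s"] by (simp add: step_def set_reg_def numeral_eq_Suc)
  from exec.Seq[OF t(2) this] have 1: "exec (Seq (compile p) ?inc) s (5 + t) ?s" by (simp add: add.commute)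
  have V': "ivar ?s v = \<rho> v" if "v \<in> V" for v
    using V that Suc.prems[of v] ivar_sem[of v p s] by (auto simp: step_def)
  have N: "ivar ?s N = ivar s N" "ivar ?s i = Suc (ivar s i)"
    using V Suc.prems[of N] V'[of N] ivar_sem[OF i] by (auto simp: step_def)
  have "r = ivar ?s N - ivar ?s i" using Suc.hyps(2) N by simp
  from Suc.hyps(1)[OF this V'] obtain u where
    u: "u \<le> 4 + r * (T + 9)"
       "exec (While ?b (Seq (compile p) ?inc)) ?s u ((step i (sem p) ^^ r) ?s)"
    using \<open>r = _\<close> by auto
  have "bval ?b s" using Suc.hyps(2) by simp
  from exec.WhileTrue[OF this 1 u(2)]
  have "exec (While ?b (Seq (compile p) ?inc)) s (9 + t + u) ((step i (sem p) ^^ Suc r) s)"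
    by (simp add: funpow_swap1 add.commute add.left_commute)
  moreover have "9 + t + u \<le> 4 + Suc r * (T + 9)" using t u by simp
  ultimately show ?case unfolding Suc.hyps(2)[symmetric] by blast
qed

text \<open>The compiled loop reads its bound before each iteration, while \<open>sem\<close> reads
  it once. Both agree because the bounds are registers in \<open>V\<close>, which the program never
  writes; their constant values \<open>\<rho>\<close> are all that the time depends on.\<close>

theorem exec_compile:
  assumes "fresh_counters p" and "V \<inter> regs p = {}" and "bounds p \<subseteq> V"
    and "\<And>v. v \<in> V \<Longrightarrow> ivar s v = \<rho> v"
  shows "\<exists>t \<le> time p \<rho>. exec (compile p) s t (sem p s)"
  using assms
proof (induction p arbitrary: s)
  case PSkip
  show ?case using exec.Skip[of s] by (intro exI[of _ 1]) simp
next
  case (PI v e)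
  show ?case using exec.IAssign[of v e s]
    by (intro exI[of _ "time (PI v e) \<rho>"]) (simp add: set_reg_def)
next
  case (PA a e f)
  show ?case using exec.IStore[of a e f s] by (intro exI[of _ "time (PA a e f) \<rho>"]) simp
next
  case (PR a e f g)
  show ?case using exec.RStore[of a e f g s] by (intro exI[of _ "time (PR a e f g) \<rho>"]) simp
next
  case (PSeq p q)
  have "\<exists>t \<le> time p \<rho>. exec (compile p) s t (sem p s)"
    by (rule PSeq.IH(1)) (use PSeq.prems in auto)
  then obtain t where t: "t \<le> time p \<rho>" "exec (compile p) s t (sem p s)" by blast
  have "ivar (sem p s) v = \<rho> v" if "v \<in> V" for v
    using PSeq.prems that ivar_sem[of v p s] by auto
  then have "\<exists>u \<le> time q \<rho>. exec (compile q) (sem p s) u (sem q (sem p s))"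
    by (intro PSeq.IH(2)) (use PSeq.prems in auto)
  then obtain u where
    u: "u \<le> time q \<rho>" "exec (compile q) (sem p s) u (sem q (sem p s))" by blast
  from exec.Seq[OF t(2) u(2)] t u show ?case
    by (intro exI[of _ "1 + t + u"]) auto
next
  case (PIf e p q)
  have "\<exists>t \<le> time p \<rho>. exec (compile p) s t (sem p s)"
    by (rule PIf.IH(1)) (use PIf.prems in auto)
  then obtain t where t: "t \<le> time p \<rho>" "exec (compile p) s t (sem p s)" by blast
  have "\<exists>u \<le> time q \<rho>. exec (compile q) s u (sem q s)"
    by (rule PIf.IH(2)) (use PIf.prems in auto)
  then obtain u where u: "u \<le> time q \<rho>" "exec (compile q) s u (sem q s)" by blast
  show ?case
  proof (cases "bval e s")
    case True
    from exec.IfTrue[OF this t(2)] True t show ?thesis by (intro exI[of _ "1 + bcost e + t"]) auto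
  next
    case False
    from exec.IfFalse[OF this u(2)] False u show ?thesis
      by (intro exI[of _ "1 + bcost e + u"]) auto
  qed
next
  case (PFor i N p)
  let ?s = "set_reg i 0 s"
  let ?w = "While (ILess (IVar i) (IVar N)) (Seq (compile p) (IAssign i (IPlus (IVar i) (IConst 1))))"
  have V: "V \<inter> insert i (regs p) = {}" "N \<in> V" "i \<notin> regs p" using PFor.prems by auto
  then have s: "ivar ?s v = \<rho> v" if "v \<in> V" for v using PFor.prems that by auto
  have "\<exists>t \<le> 4 + (ivar ?s N - ivar ?s i) * (time p \<rho> + 9).
      exec ?w ?s t ((step i (sem p) ^^ (ivar ?s N - ivar ?s i)) ?s)"
  proof (rule exec_While_counter[where V = V and \<rho> = \<rho>])
    show "\<exists>t \<le> time p \<rho>. exec (compile p) s t (sem p s)" if "\<And>v. v \<in> V \<Longrightarrow> ivar s v = \<rho> v" for s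
      by (rule PFor.IH) (use PFor.prems that in auto)
  qed (use V s in auto)
  moreover have "ivar ?s N - ivar ?s i = \<rho> N" "ivar s N = \<rho> N" using V s PFor.prems by auto
  ultimately obtain t where t: "t \<le> 4 + \<rho> N * (time p \<rho> + 9)"
    "exec ?w ?s t ((step i (sem p) ^^ \<rho> N) ?s)" by auto
  have "exec (IAssign i (IConst 0)) s 2 ?s" using exec.IAssign[of i "IConst 0" s]
    by (simp add: set_reg_def numeral_eq_Suc)
  from exec.Seq[OF this t(2)] t(1) \<open>ivar s N = \<rho> N\<close> show ?case
    by (intro exI[of _ "3 + t"]) (auto simp: numeral_eq_Suc)
qed

section \<open>Polynomial bounds for the running time\<close>

definition sizes :: "nat \<Rightarrow> nat \<Rightarrow> vname \<Rightarrow> nat" where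
  "sizes m n = (\<lambda>_. 0)(''m'' := m, ''n'' := n, ''M'' := Suc m)"

text \<open>For m, n \<ge> 1 the monomial is at least 1 and absorbs additive constants. As the
  exponents are parameters, a bound follows by introduction rules along the syntax of the
  program.\<close>

definition runs_in :: "prog \<Rightarrow> nat \<Rightarrow> nat \<Rightarrow> bool" where
  "runs_in p a b \<longleftrightarrow> (\<exists>C. \<forall>m\<ge>1. \<forall>n\<ge>1. time p (sizes m n) \<le> C * (m ^ a * n ^ b))"

lemma runs_inI:
  assumes "\<And>m n. m \<ge> 1 \<Longrightarrow> n \<ge> 1 \<Longrightarrow> time p (sizes m n) \<le> C * (m ^ a * n ^ b)"
  shows "runs_in p a b"
  using assms unfolding runs_in_def by blast

lemma runs_in_const:
  assumes "\<And>\<rho>. time p \<rho> = C"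
  shows "runs_in p a b"
proof (rule runs_inI)
  fix m n :: nat assume "m \<ge> 1" "n \<ge> 1"
  then have "1 \<le> m ^ a * n ^ b" by simp
  then show "time p (sizes m n) \<le> C * (m ^ a * n ^ b)" using assms mult_le_mono2[of 1 "m ^ a * n ^ b" C] by (simp only: mult.right_neutral)
qed

lemma runs_in_atom [intro]:
  "runs_in PSkip a b" "runs_in (PI v e) a b" "runs_in (PA x e f) a b" "runs_in (PR x e f g) a b"
  by (rule runs_in_const, simp)+

lemma runs_in_add:
  assumes "runs_in p a b" "runs_in q a b"
    and r: "\<And>\<rho>. time r \<rho> = K + time p \<rho> + time q \<rho>"
  shows "runs_in r a b"
proof -
  obtain C D where C: "\<And>m n. m \<ge> 1 \<Longrightarrow> n \<ge> 1 \<Longrightarrow> time p (sizes m n) \<le> C * (m ^ a * n ^ b)"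
    and D: "\<And>m n. m \<ge> 1 \<Longrightarrow> n \<ge> 1 \<Longrightarrow> time q (sizes m n) \<le> D * (m ^ a * n ^ b)"
    using assms unfolding runs_in_def by blast
  show ?thesis
  proof (rule runs_inI[where C = "K + C + D"])
    fix m n :: nat assume mn: "m \<ge> 1" "n \<ge> 1"
    then have "1 \<le> m ^ a * n ^ b" by simp
    then have "K \<le> K * (m ^ a * n ^ b)" by (metis mult.right_neutral mult_le_mono2)
    then show "time r (sizes m n) \<le> (K + C + D) * (m ^ a * n ^ b)"
      using C[OF mn] D[OF mn] unfolding r add_mult_distrib by linarith
  qed
qed

lemma runs_in_Seq [intro]: "runs_in p a b \<Longrightarrow> runs_in q a b \<Longrightarrow> runs_in (p ;; q) a b"
  by (rule runs_in_add[where K = 1]) auto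

lemma runs_in_If [intro]: "runs_in p a b \<Longrightarrow> runs_in q a b \<Longrightarrow> runs_in (PIf e p q) a b"
  by (rule runs_in_add[where K = "1 + bcost e"]) auto

lemma runs_in_For:
  assumes "runs_in p a b"
    and N: "\<And>m n. m \<ge> 1 \<Longrightarrow> n \<ge> 1 \<Longrightarrow> sizes m n N * (m ^ a * n ^ b) \<le> D * (m ^ a' * n ^ b')"
  shows "runs_in (PFor i N p) a' b'"
proof -
  obtain C where C: "\<And>m n. m \<ge> 1 \<Longrightarrow> n \<ge> 1 \<Longrightarrow> time p (sizes m n) \<le> C * (m ^ a * n ^ b)"
    using assms unfolding runs_in_def by blast
  show ?thesis
  proof (rule runs_inI[where C = "7 + (C + 9) * D"])
    fix m n :: nat assume mn: "m \<ge> 1" "n \<ge> 1"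
    have "1 \<le> m ^ a * n ^ b" "1 \<le> m ^ a' * n ^ b'" using mn by simp_all
    then have "time p (sizes m n) + 9 \<le> (C + 9) * (m ^ a * n ^ b)"
      using C[OF mn] unfolding add_mult_distrib by linarith
    then have "sizes m n N * (time p (sizes m n) + 9) \<le> sizes m n N * ((C + 9) * (m ^ a * n ^ b))"
      by (rule mult_le_mono2)
    also have "\<dots> = (C + 9) * (sizes m n N * (m ^ a * n ^ b))" by (simp only: mult.left_commute)
    also have "\<dots> \<le> (C + 9) * (D * (m ^ a' * n ^ b'))" by (rule mult_le_mono2[OF N[OF mn]])
    finally have "sizes m n N * (time p (sizes m n) + 9) \<le> (C + 9) * D * (m ^ a' * n ^ b')"
      by (simp only: mult.assoc)
    then show "time (PFor i N p) (sizes m n) \<le> (7 + (C + 9) * D) * (m ^ a' * n ^ b')"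
      using \<open>1 \<le> m ^ a' * n ^ b'\<close> unfolding time.simps add_mult_distrib by linarith
  qed
qed

lemma runs_in_For_m [intro]: "runs_in p a b \<Longrightarrow> runs_in (PFor i ''m'' p) (Suc a) b"
  by (erule runs_in_For[where D = 1]) (simp add: sizes_def)

text \<open>The bound \<open>M\<close> is m + 1, which is at most 2 m, so such a loop also counts as
  one factor m.\<close>

lemma runs_in_For_M [intro]: "runs_in p a b \<Longrightarrow> runs_in (PFor i ''M'' p) (Suc a) b"
  by (erule runs_in_For[where D = 2]) (simp add: sizes_def)

lemma runs_in_For_n [intro]: "runs_in p a b \<Longrightarrow> runs_in (PFor i ''n'' p) a (Suc b)"
  by (erule runs_in_For[where D = 1]) (simp add: sizes_def)


section \<open>Closed walks in gainfree systems\<close>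

text \<open>A triple \<open>(t, j, h)\<close> stands for the passage from the tail element \<open>t\<close> of the hyperarc \<open>j\<close>
  to its head \<open>h\<close>.\<close>

definition arc :: "real mat \<Rightarrow> nat \<times> nat \<times> nat \<Rightarrow> bool" where
  "arc A = (\<lambda>(t, j, h). t < dim_row A \<and> h < dim_row A \<and> j < dim_col A \<and>
     A $$ (t, j) < 0 \<and> A $$ (h, j) = 1)"

primrec walk :: "real mat \<Rightarrow> nat \<Rightarrow> (nat \<times> nat \<times> nat) list \<Rightarrow> nat \<Rightarrow> bool" where
  "walk A u [] v \<longleftrightarrow> u = v"
| "walk A u (a # as) v \<longleftrightarrow> fst a = u \<and> arc A a \<and> walk A (snd (snd a)) as v"

text \<open>For a directed cycle this is the reciprocal of its gain.\<close>

definition walk_weight :: "real mat \<Rightarrow> (nat \<times> nat \<times> nat) list \<Rightarrow> real" where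
  "walk_weight A as = prod_list (map (\<lambda>a. - A $$ (fst a, fst (snd a))) as)"

lemma walk_append: "walk A u (as @ bs) v \<longleftrightarrow> (\<exists>w. walk A u as w \<and> walk A w bs v)"
  by (induction as arbitrary: u) auto

lemma walk_arc: "walk A u as v \<Longrightarrow> a \<in> set as \<Longrightarrow> arc A a"
  by (induction as arbitrary: u) auto

lemma walk_weight_pos:
  assumes "walk A u as v"
  shows "walk_weight A as > 0"
  using assms
proof (induction as arbitrary: u)
  case (Cons a as)
  then show ?case by (auto simp: walk_weight_def arc_def intro!: mult_neg_pos)
qed (simp add: walk_weight_def)

lemma walk_heads:
  "walk A u as v \<Longrightarrow> u # map (\<lambda>a. snd (snd a)) as = map fst as @ [v]"
  by (induction as arbitrary: u) auto

lemma leontief_unique: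
  assumes "leontief A" "j < dim_col A" "i < dim_row A" "k < dim_row A" "A $$ (i, j) > 0" "A $$ (k, j) > 0"
  shows "i = k"
proof -
  let ?S = "{i. i < dim_row A \<and> A $$ (i, j) > 0}"
  have "card ?S \<le> Suc 0" using assms by (auto simp: leontief_def)
  moreover have "finite ?S" by simp
  ultimately show ?thesis using assms by (auto simp: card_le_Suc0_iff_eq)
qed

lemma head_eq:
  assumes "leontief A" "j < dim_col A" "h < dim_row A" "A $$ (h, j) = 1"
  shows "head A j = Some h"
proof -
  have "(THE i. i < dim_row A \<and> A $$ (i, j) = 1) = h"
  proof (rule the_equality)
    fix i assume "i < dim_row A \<and> A $$ (i, j) = 1"
    then show "i = h" by (intro leontief_unique[OF assms(1,2)]) (use assms in auto)
  qed (use assms in simp)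
  then show ?thesis unfolding head_def using assms(3,4) by auto
qed

text \<open>Gainfreeness speaks only of cycles without repetitions. A closed walk with distinct
  start vertices is such a cycle. Any other nonempty one is cut at a repeated vertex into two
  shorter closed walks, whose weights multiply to the given weight.\<close>

lemma closed_walk_weight:
  assumes A: "leontief A" "gainfree A" and "walk A u as u"
  shows "1 \<le> walk_weight A as"
  using assms(3)
proof (induction "length as" arbitrary: u as rule: less_induct)
  case less
  show ?case
  proof (cases "as = [] \<or> \<not> distinct (map fst as)")
    case False
    define vs where "vs = map fst as @ [u]"
    define es where "es = map (\<lambda>a. fst (snd a)) as"
    have heads: "u # map (\<lambda>a. snd (snd a)) as = vs"
      using walk_heads[OF less.prems] by (simp add: vs_def)
    have at: "vs ! i = fst (as ! i)" "vs ! Suc i = snd (snd (as ! i))" "es ! i = fst (snd (as ! i))"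
      if "i < length as" for i
    proof -
      show "vs ! i = fst (as ! i)" using that by (simp add: vs_def nth_append)
      show "vs ! Suc i = snd (snd (as ! i))" unfolding heads[symmetric] using that by simp
      show "es ! i = fst (snd (as ! i))" using that by (simp add: es_def)
    qed
    have arcs: "arc A (as ! i)" if "i < length as" for i
      using walk_arc[OF less.prems] that by simp
    have head: "head A (es ! i) = Some (vs ! Suc i)" if "i < length as" for i
      using arcs[OF that] at[OF that] head_eq[OF A(1)] by (cases "as ! i") (auto simp: arc_def)
    \<comment> \<open>The heads of the arcs are a rotation of their start vertices and therefore
      distinct as well. As a hyperarc determines its head, no hyperarc can occur twice.\<close>
    have "distinct (tl vs)"
    proof -
      have "tl vs = rotate1 (map fst as)"
        using False walk_heads[OF less.prems] by (cases as) (auto simp: vs_def)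
      then show ?thesis using False by (metis distinct1_rotate)
    qed
    then have tl: "i = k" if "vs ! Suc i = vs ! Suc k" "i < length as" "k < length as" for i k
      using that nth_eq_iff_index_eq[of "tl vs" i k] by (simp add: nth_tl vs_def)
    have "distinct es"
      unfolding distinct_conv_nth
    proof (intro allI impI notI)
      fix i k assume "i < length es" "k < length es" "i \<noteq> k" "es ! i = es ! k"
      then show False using head[of i] head[of k] tl[of i k] by (auto simp: es_def)
    qed
    moreover have "hd vs = last vs" unfolding vs_def using heads[unfolded vs_def]
      by (metis last_snoc list.sel(1))
    moreover have "set vs \<subseteq> {..<dim_row A}" "set es \<subseteq> {..<dim_col A}"
      using walk_arc[OF less.prems] False walk_arc[OF less.prems, of "hd as"] heads
      by (cases as; force simp: vs_def es_def arc_def)+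
    moreover have "vs ! i \<in> tail A (es ! i)" if "i < length as" for i
      using arcs[OF that] at[OF that] by (cases "as ! i") (auto simp: arc_def tail_def)
    ultimately have "directed_cycle A vs es"
      using False head by (auto simp: directed_cycle_def vs_def es_def)
    then have g: "gain A vs es \<le> 1" using A(2) by (auto simp: gainfree_def)
    have "walk_weight A as = (\<Prod>i < length es. weight A (es ! i) (vs ! i))"
      unfolding walk_weight_def prod.list_conv_set_nth
      by (rule prod.cong) (auto simp: es_def weight_def at)
    then have "1 / walk_weight A as \<le> 1" using g by (simp add: gain_def)
    then show ?thesis using walk_weight_pos[OF less.prems] by (simp add: divide_le_eq)
  next
    case True
    show ?thesis
    proof (cases "as = []")
      case False
      with True have "\<not> distinct (map fst as)" by blast
      from not_distinct_decomp[OF this] obtain xs ys zs y where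
        "map fst as = xs @ [y] @ ys @ [y] @ zs" by blast
      then obtain P a Q b R where as: "as = P @ a # Q @ b # R" and y: "fst a = fst b"
        by (auto simp: map_eq_append_conv map_eq_Cons_conv append_eq_map_conv)
      have w: "walk A (fst b) (a # Q) (fst b)" "walk A u (P @ b # R) u"
        using less.prems y unfolding as by (auto simp: walk_append)
      have "1 \<le> walk_weight A (a # Q)" "1 \<le> walk_weight A (P @ b # R)"
        by (rule less.hyps[OF _ w(1)] less.hyps[OF _ w(2)]; simp add: as)+
      then have "1 * 1 \<le> walk_weight A (a # Q) * walk_weight A (P @ b # R)"
        by (intro mult_mono) auto
      then show ?thesis by (simp add: as walk_weight_def mult_ac)
    qed (simp add: walk_weight_def)
  qed
qed


section \<open>Lexicographic value iteration\<close>

definition lex_less :: "real \<Rightarrow> real \<Rightarrow> real \<Rightarrow> real \<Rightarrow> bool" where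
  "lex_less a b c d \<longleftrightarrow> a < c \<or> a = c \<and> b < d"

locale gainfree_leontief =
  fixes A :: "real mat" and m n :: nat
  assumes carrier: "A \<in> carrier_mat m n" and leontief: "leontief A" and gainfree: "gainfree A"
begin

definition col_head :: "nat \<Rightarrow> nat" where
  "col_head j = (if \<exists>i<m. A $$ (i, j) > 0 then THE i. i < m \<and> A $$ (i, j) > 0 else m)"

definition coef :: "nat \<Rightarrow> nat \<Rightarrow> real" where
  "coef i j = (if A $$ (i, j) < 0 then - A $$ (i, j) else 0)"

lemma coef_nonneg: "0 \<le> coef i j"
  by (simp add: coef_def)

lemma col_headI:
  assumes "i < m" "j < n" "A $$ (i, j) > 0"
  shows "col_head j = i"
proof -
  have "(THE i. i < m \<and> A $$ (i, j) > 0) = i"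
  proof (rule the_equality)
    fix k assume "k < m \<and> A $$ (k, j) > 0"
    then show "k = i" by (intro leontief_unique[OF leontief]) (use assms carrier in auto)
  qed (use assms in simp)
  then show ?thesis unfolding col_head_def using assms by auto
qed

lemma col_head_le: "j < n \<Longrightarrow> col_head j \<le> m"
proof (cases "\<exists>i<m. A $$ (i, j) > 0")
  case True
  then show "j < n \<Longrightarrow> col_head j \<le> m" using col_headI by (metis less_imp_le_nat)
next
  case False
  then have "col_head j = m" unfolding col_head_def by (rule if_not_P)
  then show ?thesis by simp
qed

text \<open>Columns without positive entry are covered too: their head \<open>m\<close> is not a
  row, so the indicator vanishes.\<close>

lemma entry_eq:
  assumes "i < m" "j < n"
  shows "A $$ (i, j) = (if i = col_head j then 1 else 0) - coef i j"
proof -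
  have *: "A $$ (i, j) > 0 \<Longrightarrow> A $$ (i, j) = 1"
    using leontief assms carrier by (auto simp: leontief_def)
  show ?thesis
  proof (cases "A $$ (i, j) > 0")
    case True
    then show ?thesis using * col_headI[OF assms] by (simp add: coef_def)
  next
    case False
    have "i \<noteq> col_head j"
    proof
      assume i: "i = col_head j"
      then obtain k where k: "k < m" "A $$ (k, j) > 0"
        using assms(1) by (auto simp: col_head_def split: if_splits)
      with col_headI[OF k(1) assms(2) k(2)] i False show False by simp
    qed
    then show ?thesis using False by (simp add: coef_def)
  qed
qed

lemma entry_head: "j < n \<Longrightarrow> col_head j < m \<Longrightarrow> A $$ (col_head j, j) = 1"
  using entry_eq[of "col_head j" j] by (auto simp: coef_def split: if_splits)

end

text \<open>The vertices are the rows \<open>0, \<dots>, m - 1\<close> together with a root \<open>m\<close>, which serves as the head of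
  the columns without a positive entry. The value of a vertex is the pair of \<open>B\<close> and \<open>V\<close>, standing
  for \<open>B * \<omega> + V\<close> with \<open>\<omega>\<close> infinitely large, and \<open>X k h\<close> is the flow whose cost is \<open>V k h\<close>.
  The choice \<open>P k h\<close> is the successor of the column used, or 0 if the value was kept.\<close>

locale value_iteration = gainfree_leontief +
  fixes c :: "nat \<Rightarrow> real" and B V :: "nat \<Rightarrow> nat \<Rightarrow> real" and X :: "nat \<Rightarrow> nat \<Rightarrow> nat \<Rightarrow> real"
    and P :: "nat \<Rightarrow> nat \<Rightarrow> nat"
  assumes B_0: "h \<le> m \<Longrightarrow> B 0 h = (if h < m then 1 else 0)"
    and V_0: "h \<le> m \<Longrightarrow> V 0 h = 0"
    and X_0: "h \<le> m \<Longrightarrow> e < n \<Longrightarrow> X 0 h e = 0"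
    and stay: "k \<le> m \<Longrightarrow> h \<le> m \<Longrightarrow> P (Suc k) h = 0 \<Longrightarrow>
      B (Suc k) h = B k h \<and> V (Suc k) h = V k h \<and> (\<forall>e<n. X (Suc k) h e = X k h e)"
    and move: "k \<le> m \<Longrightarrow> h \<le> m \<Longrightarrow> P (Suc k) h = Suc j \<Longrightarrow> j < n \<and> col_head j = h \<and>
      B (Suc k) h = (\<Sum>t<m. coef t j * B k t) \<and>
      V (Suc k) h = c j + (\<Sum>t<m. coef t j * V k t) \<and>
      (\<forall>e<n. X (Suc k) h e = (if e = j then 1 else 0) + (\<Sum>t<m. coef t j * X k t e)) \<and>
      lex_less (B (Suc k) h) (V (Suc k) h) (B k h) (V k h)"
    and least: "k \<le> m \<Longrightarrow> j < n \<Longrightarrow> col_head j = h \<Longrightarrow>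
      \<not> lex_less (\<Sum>t<m. coef t j * B k t) (c j + (\<Sum>t<m. coef t j * V k t))
        (B (Suc k) h) (V (Suc k) h)"
begin

text \<open>The quantities that the chosen columns pass on linearly, with nonnegative start values
  and additive terms. Both the entries of \<open>X\<close> and the leftovers are of this kind, so
  one monotonicity argument serves both. The values \<open>V\<close> need not be, since costs may be
  negative.\<close>

definition flow_functional :: "(nat \<Rightarrow> nat \<Rightarrow> real) \<Rightarrow> (nat \<Rightarrow> real) \<Rightarrow> bool" where
  "flow_functional F \<kappa> \<longleftrightarrow> (\<forall>h\<le>m. 0 \<le> F 0 h) \<and> (\<forall>j. 0 \<le> \<kappa> j) \<and>
     (\<forall>k\<le>m. \<forall>h\<le>m. P (Suc k) h = 0 \<longrightarrow> F (Suc k) h = F k h) \<and>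
     (\<forall>k\<le>m. \<forall>h\<le>m. \<forall>j. P (Suc k) h = Suc j \<longrightarrow> F (Suc k) h = \<kappa> j + (\<Sum>t<m. coef t j * F k t))"

lemma
  assumes "flow_functional F \<kappa>"
  shows flow_functional_0: "h \<le> m \<Longrightarrow> 0 \<le> F 0 h"
    and flow_functional_const: "0 \<le> \<kappa> j"
    and flow_functional_stay: "k \<le> m \<Longrightarrow> h \<le> m \<Longrightarrow> P (Suc k) h = 0 \<Longrightarrow> F (Suc k) h = F k h"
    and flow_functional_move: "k \<le> m \<Longrightarrow> h \<le> m \<Longrightarrow> P (Suc k) h = Suc j \<Longrightarrow>
      F (Suc k) h = \<kappa> j + (\<Sum>t<m. coef t j * F k t)"
  using assms unfolding flow_functional_def by blast+

lemma flow_functional_nonneg: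
  assumes F: "flow_functional F \<kappa>"
  shows "k \<le> Suc m \<Longrightarrow> h \<le> m \<Longrightarrow> 0 \<le> F k h"
proof (induction k arbitrary: h)
  case 0
  then show ?case using flow_functional_0[OF F] by simp
next
  case (Suc k)
  show ?case
  proof (cases "P (Suc k) h")
    case 0
    then show ?thesis using Suc flow_functional_stay[OF F, of k h] by simp
  next
    case P: (Suc j)
    have "0 \<le> (\<Sum>t<m. coef t j * F k t)"
      by (intro sum_nonneg mult_nonneg_nonneg coef_nonneg Suc.IH) (use Suc.prems in auto)
    then show ?thesis
      using Suc.prems flow_functional_move[OF F _ _ P] flow_functional_const[OF F, of j] by simp
  qed
qed

text \<open>All terms of the recursion are nonnegative, so each single one is a lower bound. A chain
  uses the term of the tail element to which it descends.\<close>

lemma flow_functional_step: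
  assumes F: "flow_functional F \<kappa>" and k: "k \<le> m" "h \<le> m" "P (Suc k) h = Suc j" and t: "t < m"
  shows "coef t j * F k t \<le> F (Suc k) h"
proof -
  have "coef t j * F k t \<le> (\<Sum>t<m. coef t j * F k t)"
  proof (rule member_le_sum)
    fix i assume "i \<in> {..<m} - {t}"
    then show "0 \<le> coef i j * F k i"
      using k by (intro mult_nonneg_nonneg coef_nonneg flow_functional_nonneg[OF F]) auto
  qed (use t in auto)
  then show ?thesis
    using flow_functional_move[OF F k] flow_functional_const[OF F, of j] by simp
qed

text \<open>The vertex \<open>v k\<close> of a chain lives on level \<open>m + 1 - k\<close>.\<close>

definition chain :: "(nat \<Rightarrow> nat) \<Rightarrow> bool" where
  "chain v \<longleftrightarrow> (\<forall>k\<le>m. v k < m) \<and>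
     (\<forall>k<m. \<exists>j. P (Suc m - k) (v k) = Suc j \<and> A $$ (v (Suc k), j) < 0)"

text \<open>A chain descends from heads to tail elements, so read backwards it is a walk. Each arc
  contributes one use of \<open>flow_functional_step\<close>, and the coefficients multiply to the
  weight of the walk.\<close>

lemma chain_walk:
  assumes v: "chain v" and "i \<le> j" "j \<le> m"
  shows "\<exists>as. walk A (v j) as (v i) \<and> (\<forall>F \<kappa>. flow_functional F \<kappa> \<longrightarrow>
    walk_weight A as * F (Suc m - j) (v j) \<le> F (Suc m - i) (v i))"
  using assms(2,3)
proof (induction j rule: dec_induct)
  case base
  show ?case by (rule exI[of _ "[]"]) (simp add: walk_weight_def)
next
  case (step j)
  then obtain as where as: "walk A (v j) as (v i)" and
    le: "\<And>F \<kappa>. flow_functional F \<kappa> \<Longrightarrow>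
      walk_weight A as * F (Suc m - j) (v j) \<le> F (Suc m - i) (v i)" by auto
  obtain e where e: "P (Suc (m - j)) (v j) = Suc e" "A $$ (v (Suc j), e) < 0"
  proof -
    have "j < m" using step.prems by simp
    then have "\<exists>e. P (Suc m - j) (v j) = Suc e \<and> A $$ (v (Suc j), e) < 0"
      using v unfolding chain_def by blast
    then show thesis using that \<open>j < m\<close> by (auto simp: Suc_diff_le)
  qed
  have lt: "v j < m" "v (Suc j) < m" using v step.prems by (auto simp: chain_def)
  have hd: "e < n" "col_head e = v j" using move[of "m - j" "v j" e] e lt by auto
  let ?as = "(v (Suc j), e, v j) # as"
  have "walk A (v (Suc j)) ?as (v i)"
    using as e lt hd carrier entry_head[OF hd(1)] by (auto simp: arc_def)
  moreover have "walk_weight A ?as * F (Suc m - Suc j) (v (Suc j)) \<le> F (Suc m - i) (v i)"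
    if F: "flow_functional F \<kappa>" for F \<kappa>
  proof -
    have "coef (v (Suc j)) e * F (m - j) (v (Suc j)) \<le> F (Suc (m - j)) (v j)"
      by (rule flow_functional_step[OF F _ _ e(1)]) (use lt in auto)
    then have "walk_weight A as * (coef (v (Suc j)) e * F (m - j) (v (Suc j)))
        \<le> walk_weight A as * F (Suc (m - j)) (v j)"
      using walk_weight_pos[OF as] by simp
    also have "\<dots> \<le> F (Suc m - i) (v i)" using le[OF F] step.prems by (simp add: Suc_diff_le)
    finally show ?thesis using e by (simp add: walk_weight_def coef_def mult_ac)
  qed
  ultimately show ?case by blast
qed

text \<open>This is where gainfreeness enters: between two visits of a vertex the walk is closed, so
  its weight is at least one. Since \<open>i < j\<close>, the index \<open>i\<close> belongs to the
  higher level.\<close>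

lemma chain_mono:
  assumes v: "chain v" and ij: "i < j" "j \<le> m" "v i = v j" and F: "flow_functional F \<kappa>"
  shows "F (Suc m - j) (v j) \<le> F (Suc m - i) (v i)"
proof -
  obtain as where as: "walk A (v j) as (v i)"
    and le: "walk_weight A as * F (Suc m - j) (v j) \<le> F (Suc m - i) (v i)"
    using chain_walk[OF v, of i j] ij F by auto
  have "1 \<le> walk_weight A as" using as closed_walk_weight[OF leontief gainfree] ij by simp
  moreover have "0 \<le> F (Suc m - j) (v j)"
    by (rule flow_functional_nonneg[OF F]) (use v ij in \<open>auto simp: chain_def less_imp_le\<close>)
  ultimately have "1 * F (Suc m - j) (v j) \<le> walk_weight A as * F (Suc m - j) (v j)"
    by (rule mult_right_mono)
  with le show ?thesis by simp
qed

text \<open>Pigeonhole principle for m + 1 positions and m rows. The root is never a tail element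
  and does not occur in chains.\<close>

lemma chain_repeats:
  assumes "chain v"
  shows "\<exists>i j. i < j \<and> j \<le> m \<and> v i = v j"
proof -
  have "\<not> inj_on v {..m}"
  proof
    assume "inj_on v {..m}"
    then have "card {..m} \<le> card {..<m}"
      by (rule card_inj_on_le) (use assms in \<open>auto simp: chain_def\<close>)
    then show False by simp
  qed
  then obtain i j where "i \<le> m" "j \<le> m" "i \<noteq> j" "v i = v j" by (auto simp: inj_on_def)
  then show ?thesis by (metis nat_neq_iff)
qed

section \<open>Flows and the demand they leave uncovered\<close>

lemma X_functional:
  assumes "e < n"
  shows "flow_functional (\<lambda>k h. X k h e) (\<lambda>j. if e = j then 1 else 0)"
  unfolding flow_functional_def
proof (intro conjI allI impI)
  fix k h assume "k \<le> m" "h \<le> m" "P (Suc k) h = 0"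
  then show "X (Suc k) h e = X k h e" using stay[of k h] assms by simp
next
  fix k h j assume "k \<le> m" "h \<le> m" "P (Suc k) h = Suc j"
  then show "X (Suc k) h e = (if e = j then 1 else 0) + (\<Sum>t<m. coef t j * X k t e)"
    using move[of k h j] assms by simp
qed (simp_all add: X_0 assms)

lemma X_nonneg: "k \<le> Suc m \<Longrightarrow> h \<le> m \<Longrightarrow> e < n \<Longrightarrow> 0 \<le> X k h e"
  using flow_functional_nonneg[OF X_functional] by blast

text \<open>The part of one unit of demand at \<open>h\<close> that the flow \<open>X k h\<close> leaves uncovered at \<open>u\<close>.\<close>

definition leftover :: "nat \<Rightarrow> nat \<Rightarrow> nat \<Rightarrow> real" where
  "leftover k h u = (if h = u then 1 else 0) - (\<Sum>e<n. A $$ (u, e) * X k h e)"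

text \<open>The weight \<open>w\<close> is arbitrary because the identity is applied both to the
  rows of \<open>A\<close>, for the leftovers, and to the costs \<open>c\<close>.\<close>

lemma linear_X_move:
  assumes "k \<le> m" "h \<le> m" "P (Suc k) h = Suc j"
  shows "(\<Sum>e<n. w e * X (Suc k) h e) = w j + (\<Sum>t<m. coef t j * (\<Sum>e<n. w e * X k t e))"
proof -
  have j: "j < n" and X: "\<And>e. e < n \<Longrightarrow>
      X (Suc k) h e = (if e = j then 1 else 0) + (\<Sum>t<m. coef t j * X k t e)"
    using move[OF assms] by auto
  have "(\<Sum>e<n. w e * X (Suc k) h e)
      = (\<Sum>e<n. (if e = j then w e else 0) + (\<Sum>t<m. coef t j * (w e * X k t e)))"
    by (rule sum.cong) (auto simp: X algebra_simps sum_distrib_left)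
  also have "\<dots> = w j + (\<Sum>e<n. \<Sum>t<m. coef t j * (w e * X k t e))"
    using j by (simp add: sum.distrib)
  also have "(\<Sum>e<n. \<Sum>t<m. coef t j * (w e * X k t e)) = (\<Sum>t<m. \<Sum>e<n. coef t j * (w e * X k t e))"
    by (rule sum.swap)
  finally show ?thesis by (simp add: sum_distrib_left)
qed

text \<open>Column \<open>j\<close> covers the unit demand at its head and creates the demand
  \<open>coef t j\<close> at each tail element \<open>t\<close>. This is served by the flows of the
  level below, so only their leftovers remain, scaled by the same coefficients.\<close>

lemma leftover_move:
  assumes k: "k \<le> m" "h \<le> m" "P (Suc k) h = Suc j" and u: "u < m"
  shows "leftover (Suc k) h u = (\<Sum>t<m. coef t j * leftover k t u)"
proof -
  have j: "j < n" "col_head j = h" using move[OF k] by auto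
  have "(\<Sum>t<m. coef t j * leftover k t u)
      = (\<Sum>t<m. (if t = u then coef t j else 0) - coef t j * (\<Sum>e<n. A $$ (u, e) * X k t e))"
    by (rule sum.cong) (auto simp: leftover_def algebra_simps)
  also have "\<dots> = coef u j - (\<Sum>t<m. coef t j * (\<Sum>e<n. A $$ (u, e) * X k t e))"
    using u by (simp add: sum_subtractf)
  finally show ?thesis
    using entry_eq[OF u j(1)] j by (auto simp: leftover_def linear_X_move[OF k])
qed

lemma leftover_functional:
  assumes u: "u < m"
  shows "flow_functional (\<lambda>k h. leftover k h u) (\<lambda>j. 0)"
  unfolding flow_functional_def
proof (intro conjI allI impI)
  fix k h assume "k \<le> m" "h \<le> m" "P (Suc k) h = 0"
  then show "leftover (Suc k) h u = leftover k h u" using stay[of k h] by (simp add: leftover_def)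
next
  fix k h j assume "k \<le> m" "h \<le> m" "P (Suc k) h = Suc j"
  then show "leftover (Suc k) h u = 0 + (\<Sum>t<m. coef t j * leftover k t u)"
    using leftover_move[of k h j u] u by simp
qed (simp_all add: leftover_def X_0)

lemma leftover_nonneg: "k \<le> Suc m \<Longrightarrow> h \<le> m \<Longrightarrow> u < m \<Longrightarrow> 0 \<le> leftover k h u"
  using flow_functional_nonneg[OF leftover_functional] by blast

text \<open>This gives the leading coefficient its meaning: every unit of uncovered demand costs one
  \<omega>.\<close>

lemma B_eq: "k \<le> Suc m \<Longrightarrow> h \<le> m \<Longrightarrow> B k h = (\<Sum>u<m. leftover k h u)"
proof (induction k arbitrary: h)
  case 0
  have "(\<Sum>u<m. leftover 0 h u) = (\<Sum>u<m. if h = u then 1 else 0)"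
    by (rule sum.cong) (use 0 X_0 in \<open>auto simp: leftover_def\<close>)
  then show ?case using 0 B_0[of h] by simp
next
  case (Suc k)
  show ?case
  proof (cases "P (Suc k) h")
    case 0
    then show ?thesis using stay[of k h] Suc by (simp add: leftover_def)
  next
    case P: (Suc j)
    have "(\<Sum>u<m. leftover (Suc k) h u) = (\<Sum>u<m. \<Sum>t<m. coef t j * leftover k t u)"
      by (rule sum.cong) (use leftover_move[OF _ _ P] Suc.prems in auto)
    also have "\<dots> = (\<Sum>t<m. coef t j * (\<Sum>u<m. leftover k t u))"
      by (subst sum.swap) (simp add: sum_distrib_left)
    also have "\<dots> = (\<Sum>t<m. coef t j * B k t)"
      by (rule sum.cong) (use Suc in auto)
    finally show ?thesis using move[OF _ _ P] Suc.prems by simp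
  qed
qed

lemma V_eq: "k \<le> Suc m \<Longrightarrow> h \<le> m \<Longrightarrow> V k h = (\<Sum>e<n. c e * X k h e)"
proof (induction k arbitrary: h)
  case 0
  then show ?case using V_0[of h] X_0[of h] by simp
next
  case (Suc k)
  show ?case
  proof (cases "P (Suc k) h")
    case 0
    then show ?thesis using stay[of k h] Suc by simp
  next
    case P: (Suc j)
    have "(\<Sum>t<m. coef t j * V k t) = (\<Sum>t<m. coef t j * (\<Sum>e<n. c e * X k t e))"
      by (rule sum.cong) (use Suc in auto)
    then show ?thesis using move[OF _ _ P] linear_X_move[OF _ _ P, of c] Suc.prems by simp
  qed
qed

lemma A_X: "(\<Sum>e<n. A $$ (u, e) * X k h e) = (if h = u then 1 else 0) - leftover k h u"
  by (simp add: leftover_def)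

section \<open>Monotonicity of values and propagation of decreases\<close>

lemma value_Suc_le: "k \<le> m \<Longrightarrow> h \<le> m \<Longrightarrow> \<not> lex_less (B k h) (V k h) (B (Suc k) h) (V (Suc k) h)"
  using stay[of k h] move[of k h] by (cases "P (Suc k) h") (auto simp: lex_less_def)

lemma value_antimono:
  assumes "k \<le> l" "l \<le> Suc m" "h \<le> m"
  shows "\<not> lex_less (B k h) (V k h) (B l h) (V l h)"
  using assms
proof (induction l rule: dec_induct)
  case (step l)
  then show ?case using value_Suc_le[of l h] by (auto simp: lex_less_def)
qed (simp add: lex_less_def)

lemma B_antimono: "k \<le> l \<Longrightarrow> l \<le> Suc m \<Longrightarrow> h \<le> m \<Longrightarrow> B l h \<le> B k h"
  using value_antimono[of k l h] by (auto simp: lex_less_def)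

lemma B_nonneg: "k \<le> Suc m \<Longrightarrow> h \<le> m \<Longrightarrow> 0 \<le> B k h"
  unfolding B_eq by (rule sum_nonneg) (simp add: leftover_nonneg)

text \<open>At the root \<open>B\<close> starts with 0, never increases and stays nonnegative. By
  \<open>B_eq\<close> the flows at the root then leave nothing uncovered.\<close>

lemma B_root: "k \<le> Suc m \<Longrightarrow> B k m = 0"
  using B_nonneg[of k m] B_antimono[of 0 k m] B_0[of m] by simp

lemma B_least:
  assumes "k \<le> m" "j < n"
  shows "B (Suc k) (col_head j) \<le> (\<Sum>t<m. coef t j * B k t)"
  using least[OF assms refl] by (auto simp: lex_less_def)

definition strict :: "nat \<Rightarrow> nat \<Rightarrow> bool" where
  "strict k h \<longleftrightarrow> lex_less (B (Suc k) h) (V (Suc k) h) (B k h) (V k h)"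

lemma strict_move:
  assumes "strict k h" "k \<le> m" "h \<le> m"
  obtains j where "P (Suc k) h = Suc j"
  using assms stay[of k h] by (cases "P (Suc k) h") (auto simp: strict_def lex_less_def)

text \<open>If no tail element of \<open>j\<close> had changed, the column would have offered the
  same value one round earlier, and \<open>least\<close> would already have bounded level
  \<open>Suc k\<close> by it.\<close>

lemma strict_step:
  assumes s: "strict (Suc k) h" and k: "Suc k \<le> m" "h \<le> m" and P: "P (Suc (Suc k)) h = Suc j"
  shows "\<exists>t<m. A $$ (t, j) < 0 \<and> strict k t"
proof (rule ccontr)
  assume no: "\<not> ?thesis"
  have j: "j < n" "col_head j = h" "B (Suc (Suc k)) h = (\<Sum>t<m. coef t j * B (Suc k) t)"
    "V (Suc (Suc k)) h = c j + (\<Sum>t<m. coef t j * V (Suc k) t)"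
    using move[OF k P] by auto
  have eq: "coef t j * B (Suc k) t = coef t j * B k t \<and> coef t j * V (Suc k) t = coef t j * V k t"
    if "t < m" for t
    using no that value_Suc_le[of k t] k by (auto simp: coef_def strict_def lex_less_def)
  have "(\<Sum>t<m. coef t j * B (Suc k) t) = (\<Sum>t<m. coef t j * B k t)"
    "(\<Sum>t<m. coef t j * V (Suc k) t) = (\<Sum>t<m. coef t j * V k t)"
    by (rule sum.cong; use eq in simp)+
  with s j least[OF _ j(1,2), of k] k show False by (simp add: strict_def lex_less_def)
qed

text \<open>The version of \<open>strict_step\<close> for \<open>B\<close> alone. It is needed
  separately because the vertex found there may have decreased only in its \<open>V\<close>
  component.\<close>

lemma B_strict_step:
  assumes s: "B (Suc (Suc k)) h < B (Suc k) h" and k: "Suc k \<le> m" "h \<le> m"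
  shows "\<exists>j t. P (Suc (Suc k)) h = Suc j \<and> t < m \<and> A $$ (t, j) < 0 \<and> B (Suc k) t < B k t"
proof -
  obtain j where P: "P (Suc (Suc k)) h = Suc j"
    using strict_move[of "Suc k" h] s k by (auto simp: strict_def lex_less_def)
  have j: "j < n" "col_head j = h" "B (Suc (Suc k)) h = (\<Sum>t<m. coef t j * B (Suc k) t)"
    using move[OF k P] by auto
  have "\<exists>t<m. A $$ (t, j) < 0 \<and> B (Suc k) t < B k t"
  proof (rule ccontr)
    assume no: "\<not> ?thesis"
    have "(\<Sum>t<m. coef t j * B k t) \<le> (\<Sum>t<m. coef t j * B (Suc k) t)"
    proof (rule sum_mono)
      fix t assume "t \<in> {..<m}"
      then show "coef t j * B k t \<le> coef t j * B (Suc k) t"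
      proof (cases "A $$ (t, j) < 0")
        case True
        then have "B k t \<le> B (Suc k) t" using no \<open>t \<in> _\<close> by force
        then show ?thesis by (rule mult_left_mono) (rule coef_nonneg)
      qed (simp add: coef_def)
    qed
    with s j B_least[of k j] k show False by simp
  qed
  with P show ?thesis by blast
qed

text \<open>A late decrease of \<open>B\<close> would be passed down a chain to a repeated vertex, where gainfreeness
  makes the leftovers, and hence \<open>B\<close>, move in the opposite direction. So \<open>B\<close> stabilises even if the
  dual is infeasible.\<close>

lemma B_stable:
  assumes v: "v < m"
  shows "B (Suc m) v = B m v"
proof (rule ccontr)
  assume "B (Suc m) v \<noteq> B m v"
  with B_antimono[of m "Suc m" v] v have lt: "B (Suc m) v < B m v" by simp
  \<comment> \<open>The guards make both conditions vacuous beyond the last level, so that the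
    dependent choice yields a total sequence; only its members up to \<open>m\<close>
    matter.\<close>
  define Q where "Q k h \<longleftrightarrow> k \<le> m \<longrightarrow> h < m \<and> B (Suc (m - k)) h < B (m - k) h" for k h :: nat
  define R where "R k h t \<longleftrightarrow> k < m \<longrightarrow> (\<exists>j. P (Suc m - k) h = Suc j \<and> A $$ (t, j) < 0)" for k h t :: nat
  have "\<exists>f. \<forall>k. Q k (f k) \<and> R k (f k) (f (Suc k))"
  proof (rule dependent_nat_choice)
    show "\<exists>h. Q 0 h" using v lt by (auto simp: Q_def)
  next
    fix h k assume Q: "Q k h"
    show "\<exists>t. Q (Suc k) t \<and> R k h t"
    proof (cases "k < m")
      case True
      then obtain l where l: "m - k = Suc l" "m - Suc k = l" by (metis Suc_diff_Suc)
      then have "Suc m - k = Suc (Suc l)" using True by (simp add: Suc_diff_le)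
      moreover have "B (Suc (Suc l)) h < B (Suc l) h" "Suc l \<le> m" "h \<le> m"
        using Q True l by (auto simp: Q_def)
      ultimately show ?thesis using B_strict_step[of l h] True l by (auto simp: Q_def R_def)
    qed (auto simp: Q_def R_def)
  qed
  then obtain f where f: "\<And>k. Q k (f k)" "\<And>k. R k (f k) (f (Suc k))" by blast
  then have "chain f" by (auto simp: chain_def Q_def R_def)
  from chain_repeats[OF this] obtain i j where ij: "i < j" "j \<le> m" "f i = f j" by blast
  have fm: "f i < m" "f j < m" using \<open>chain f\<close> ij by (auto simp: chain_def)
  \<comment> \<open>From here the contradiction closes: \<open>i < j\<close> gives
    \<open>Suc m - j \<le> m - i\<close>, so the drop at position \<open>i\<close> takes
    \<open>B\<close> strictly below its value on level \<open>Suc m - j\<close>, whereas summing the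
    leftovers shows that it did not fall.\<close>
  have "B (Suc m - j) (f j) \<le> B (Suc m - i) (f i)"
  proof -
    have "(\<Sum>u<m. leftover (Suc m - j) (f j) u) \<le> (\<Sum>u<m. leftover (Suc m - i) (f i) u)"
      by (rule sum_mono) (use chain_mono[OF \<open>chain f\<close> ij leftover_functional] in auto)
    then show ?thesis using fm by (simp add: B_eq)
  qed
  moreover have "B (Suc m - i) (f i) < B (m - i) (f i)"
    using f(1)[of i] ij by (auto simp: Q_def Suc_diff_le)
  moreover have "B (m - i) (f i) \<le> B (Suc m - j) (f i)"
    by (rule B_antimono) (use ij fm in auto)
  ultimately show False using ij by simp
qed

section \<open>Certificates from the last levels\<close>

lemma sum_entry:
  assumes "j < n"
  shows "(\<Sum>i<m. A $$ (i, j) * F i)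
    = (if col_head j < m then F (col_head j) else 0) - (\<Sum>t<m. coef t j * F t)"
proof -
  have "(\<Sum>i<m. A $$ (i, j) * F i)
      = (\<Sum>i<m. (if i = col_head j then F i else 0) - coef i j * F i)"
  proof (rule sum.cong)
    fix i assume "i \<in> {..<m}"
    then show "A $$ (i, j) * F i = (if i = col_head j then F i else 0) - coef i j * F i"
      using entry_eq[of i j] assms by (simp add: left_diff_distrib)
  qed simp
  then show ?thesis by (simp add: sum_subtractf)
qed

text \<open>\<open>B_least\<close> compares the head on one level with the tail elements on the
  level below. Stability of \<open>B\<close> removes this delay, and at the root both the value and
  its contribution to the sum are 0.\<close>

lemma B_farkas:
  assumes "j < n"
  shows "(\<Sum>i<m. A $$ (i, j) * B (Suc m) i) \<le> 0"
proof -
  have "(\<Sum>t<m. coef t j * B (Suc m) t) = (\<Sum>t<m. coef t j * B m t)"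
    by (rule sum.cong) (auto simp: B_stable)
  moreover have "B (Suc m) m = 0" by (rule B_root) simp
  ultimately show ?thesis
    using B_least[OF order.refl assms] col_head_le[OF assms] by (auto simp: sum_entry[OF assms])
qed

text \<open>Only those columns are treated in which the \<omega> part of the constraint is tight. In
  all others it leaves positive slack, and a sufficiently large number in place of \<omega>
  satisfies the constraint.\<close>

lemma stable_dual:
  assumes root: "0 \<le> V (Suc m) m" and stable: "\<And>v. v < m \<Longrightarrow> \<not> strict m v" and j: "j < n"
    and B: "(\<Sum>i<m. A $$ (i, j) * B (Suc m) i) = 0"
  shows "(\<Sum>i<m. A $$ (i, j) * V (Suc m) i) \<le> c j"
proof -
  have eq: "B (Suc m) t = B m t \<and> V (Suc m) t = V m t" if "t < m" for t
    using stable[OF that] value_Suc_le[of m t] that by (auto simp: strict_def lex_less_def)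
  have sums: "(\<Sum>t<m. coef t j * B (Suc m) t) = (\<Sum>t<m. coef t j * B m t)"
    "(\<Sum>t<m. coef t j * V (Suc m) t) = (\<Sum>t<m. coef t j * V m t)"
    by (rule sum.cong; use eq in simp)+
  have "B (Suc m) m = 0" by (rule B_root) simp
  then show ?thesis
    using least[OF order.refl j refl] root B col_head_le[OF j]
    by (cases "col_head j < m") (auto simp: sum_entry[OF j] sums lex_less_def)
qed

text \<open>The root is not a row and carries no demand. A flow at the root without leftover thus
  lies in the kernel of \<open>A\<close>, and its cost is the value of the root.\<close>

lemma root_ray:
  assumes "V (Suc m) m < 0"
  shows "\<forall>e<n. 0 \<le> X (Suc m) m e" "\<forall>u<m. (\<Sum>e<n. A $$ (u, e) * X (Suc m) m e) = 0"
    "(\<Sum>e<n. c e * X (Suc m) m e) < 0"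
proof -
  show "\<forall>e<n. 0 \<le> X (Suc m) m e" using X_nonneg by simp
  have "(\<Sum>u<m. leftover (Suc m) m u) = 0" using B_root[of "Suc m"] B_eq[of "Suc m" m] by simp
  then have "\<forall>u\<in>{..<m}. leftover (Suc m) m u = 0"
    by (subst (asm) sum_nonneg_eq_0_iff) (auto intro: leftover_nonneg)
  then show "\<forall>u<m. (\<Sum>e<n. A $$ (u, e) * X (Suc m) m e) = 0" by (simp add: A_X)
  show "(\<Sum>e<n. c e * X (Suc m) m e) < 0" using assms V_eq[of "Suc m" m] by simp
qed

text \<open>By \<open>chain_mono\<close> the flow and all leftovers at the higher level dominate
  those at the lower one, whereas the value there is lexicographically smaller. Hence
  \<open>B\<close> agrees on both levels, which forces every leftover to agree and the difference
  into the kernel; the strict decrease is then one of the cost.\<close>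

lemma chain_ray:
  assumes v: "chain v" and ij: "i < j" "j \<le> m" "v i = v j" and s: "strict (m - i) (v i)"
  defines "r \<equiv> \<lambda>e. X (Suc m - i) (v i) e - X (Suc m - j) (v j) e"
  shows "\<forall>e<n. 0 \<le> r e" "\<forall>u<m. (\<Sum>e<n. A $$ (u, e) * r e) = 0" "(\<Sum>e<n. c e * r e) < 0"
proof -
  let ?k = "Suc m - i" and ?l = "Suc m - j"
  have w: "v j < m" and kl: "?k \<le> Suc m" "?l \<le> Suc m" "?l \<le> m - i" "?k = Suc (m - i)"
    using v ij by (auto simp: chain_def)
  have lt: "lex_less (B ?k (v i)) (V ?k (v i)) (B ?l (v j)) (V ?l (v j))"
    using s value_antimono[of ?l "m - i" "v j"] kl w ij by (auto simp: strict_def lex_less_def)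
  show "\<forall>e<n. 0 \<le> r e" using chain_mono[OF v ij X_functional] by (simp add: r_def)
  have le: "leftover ?l (v j) u \<le> leftover ?k (v i) u" if "u < m" for u
    using chain_mono[OF v ij leftover_functional[OF that]] .
  have Bs: "B ?k (v i) = (\<Sum>u<m. leftover ?k (v i) u)" "B ?l (v j) = (\<Sum>u<m. leftover ?l (v j) u)"
    by (rule B_eq; use kl w ij in simp)+
  moreover have "B ?l (v j) \<le> B ?k (v i)" unfolding Bs by (rule sum_mono) (use le in auto)
  ultimately have Beq: "B ?k (v i) = B ?l (v j)" using lt by (auto simp: lex_less_def)
  then have "(\<Sum>u<m. leftover ?k (v i) u - leftover ?l (v j) u) = 0"
    by (simp add: Bs sum_subtractf)
  then have "\<forall>u\<in>{..<m}. leftover ?k (v i) u - leftover ?l (v j) u = 0"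
    by (subst (asm) sum_nonneg_eq_0_iff) (use le in auto)
  moreover have "(\<Sum>e<n. w e * r e) = (\<Sum>e<n. w e * X ?k (v i) e) - (\<Sum>e<n. w e * X ?l (v j) e)" for w
    by (simp add: r_def right_diff_distrib sum_subtractf)
  ultimately show "\<forall>u<m. (\<Sum>e<n. A $$ (u, e) * r e) = 0" and "(\<Sum>e<n. c e * r e) < 0"
    using lt Beq ij kl w by (simp_all add: A_X V_eq lex_less_def)
qed

text \<open>All products \<open>b v * B (Suc m) v\<close> are nonnegative with sum 0, so a vertex
  with positive demand has no leftover and its flow covers the demand exactly.\<close>

lemma flow_feasible:
  assumes b: "\<And>v. v < m \<Longrightarrow> 0 \<le> b v" and B: "(\<Sum>v<m. b v * B (Suc m) v) = 0"
  defines "x \<equiv> \<lambda>e. \<Sum>v<m. b v * X (Suc m) v e"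
  shows "\<forall>e<n. 0 \<le> x e" "\<forall>u<m. (\<Sum>e<n. A $$ (u, e) * x e) = b u"
    "(\<Sum>e<n. c e * x e) = (\<Sum>v<m. b v * V (Suc m) v)"
proof -
  show "\<forall>e<n. 0 \<le> x e" unfolding x_def
    by (auto intro!: sum_nonneg mult_nonneg_nonneg b X_nonneg)
  have lin: "(\<Sum>e<n. w e * x e) = (\<Sum>v<m. b v * (\<Sum>e<n. w e * X (Suc m) v e))" for w
  proof -
    have "(\<Sum>e<n. w e * x e) = (\<Sum>e<n. \<Sum>v<m. b v * (w e * X (Suc m) v e))"
      by (simp add: x_def sum_distrib_left mult.left_commute)
    also have "\<dots> = (\<Sum>v<m. \<Sum>e<n. b v * (w e * X (Suc m) v e))" by (rule sum.swap)
    finally show ?thesis by (simp add: sum_distrib_left)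
  qed
  have "(\<Sum>e<n. A $$ (u, e) * x e) = b u" if u: "u < m" for u
  proof -
    have "b v * B (Suc m) v = 0" if "v < m" for v
      using B that b B_nonneg by (subst (asm) sum_nonneg_eq_0_iff) auto
    moreover have "leftover (Suc m) v u \<le> B (Suc m) v" if "v < m" for v
      using B_eq[of "Suc m" v] that u leftover_nonneg[of "Suc m" v]
        member_le_sum[of u "{..<m}" "leftover (Suc m) v"] by auto
    ultimately have "b v * leftover (Suc m) v u = 0" if "v < m" for v
      using leftover_nonneg[of "Suc m" v u] that u by (metis less_imp_le_nat mult_eq_0_iff order.antisym order.refl)
    then have "(\<Sum>v<m. b v * ((if v = u then 1 else 0) - leftover (Suc m) v u))
        = (\<Sum>v<m. if v = u then b v else 0)"
      by (intro sum.cong) (auto simp: right_diff_distrib)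
    then show ?thesis using u by (simp add: lin A_X)
  qed
  then show "\<forall>u<m. (\<Sum>e<n. A $$ (u, e) * x e) = b u" by blast
  show "(\<Sum>e<n. c e * x e) = (\<Sum>v<m. b v * V (Suc m) v)"
    unfolding lin by (rule sum.cong) (auto simp: V_eq)
qed

end


section \<open>The program\<close>

definition IEq :: "iexp \<Rightarrow> iexp \<Rightarrow> bexp" where
  "IEq e f = And (Not (ILess e f)) (Not (ILess f e))"

definition LexLess :: "rexp \<Rightarrow> rexp \<Rightarrow> rexp \<Rightarrow> rexp \<Rightarrow> bexp" where
  "LexLess a b c d = Not (And (Not (RLess a c)) (Not (And (Not (RLess c a)) (RLess b d))))"

lemma bval_IEq [simp]: "bval (IEq e f) s \<longleftrightarrow> ival e s = ival f s"
  by (auto simp: IEq_def)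

lemma bval_LexLess [simp]:
  "bval (LexLess a b c d) s \<longleftrightarrow> lex_less (rval a s) (rval b s) (rval c s) (rval d s)"
  by (auto simp: LexLess_def lex_less_def)

abbreviation "I0 \<equiv> IConst 0"
abbreviation "I1 \<equiv> IConst 1"
abbreviation "entry i j \<equiv> RArr ''A'' (IVar i) j"
abbreviation "cell a \<equiv> RArr a I0 I0"
abbreviation "item a i \<equiv> RArr a (IVar i) I0"

text \<open>Vertex \<open>h\<close> on level \<open>k\<close> is row \<open>k * (m + 1) + h\<close> of the arrays \<open>Y\<close> (columns 0 and 1 hold \<open>B\<close> and
  \<open>V\<close>), \<open>X\<close> and \<open>pol\<close>; the register \<open>o\<close> points to the first row of the current level. As \<open>o\<close> is
  advanced by additions, no multiplication of indices is needed.\<close>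

definition find_head :: prog where
  "find_head = PFor ''i'' ''m'' (PIf (RLess (RConst 0) (entry ''i'' (IVar ''j'')))
     (PA ''hd'' (IVar ''j'') (IVar ''i'')) PSkip)"

definition heads :: prog where
  "heads = PFor ''j'' ''n'' (PA ''hd'' (IVar ''j'') (IVar ''m'') ;; find_head)"

definition start :: prog where
  "start = PFor ''h'' ''m'' (PR ''Y'' (IVar ''h'') I0 (RConst 1))"

definition column_value :: prog where
  "column_value = PR ''S'' I0 I0 (RConst 0) ;; PR ''S'' I0 I1 (item ''c'' ''j'') ;;
     PFor ''t'' ''m'' (PIf (RLess (entry ''t'' (IVar ''j'')) (RConst 0))
       (PR ''S'' I0 I0 (RMinus (RArr ''S'' I0 I0)
          (RTimes (entry ''t'' (IVar ''j'')) (RArr ''Y'' (IPlus (IVar ''o'') (IVar ''t'')) I0))) ;;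
        PR ''S'' I0 I1 (RMinus (RArr ''S'' I0 I1)
          (RTimes (entry ''t'' (IVar ''j'')) (RArr ''Y'' (IPlus (IVar ''o'') (IVar ''t'')) I1))))
       PSkip)"

text \<open>Row \<open>R\<close> already holds the old value when this loop starts. So only strict
  improvements are accepted, and \<open>q = 0\<close> survives exactly if there is none.\<close>

definition best_column :: prog where
  "best_column = PFor ''j'' ''n'' (PIf (IEq (IArr ''hd'' (IVar ''j'')) (IVar ''h''))
     (column_value ;;
      PIf (LexLess (RArr ''S'' I0 I0) (RArr ''S'' I0 I1)
             (RArr ''Y'' (IVar ''R'') I0) (RArr ''Y'' (IVar ''R'') I1))
        (PR ''Y'' (IVar ''R'') I0 (RArr ''S'' I0 I0) ;;
         PR ''Y'' (IVar ''R'') I1 (RArr ''S'' I0 I1) ;;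
         PI ''q'' (IPlus (IVar ''j'') I1)) PSkip) PSkip)"

definition add_tail_flow :: prog where
  "add_tail_flow = PFor ''t'' ''m'' (PIf (RLess (entry ''t'' (IMinus (IVar ''q'') I1)) (RConst 0))
     (PR ''X'' (IVar ''R'') (IVar ''e'') (RMinus (RArr ''X'' (IVar ''R'') (IVar ''e''))
        (RTimes (entry ''t'' (IMinus (IVar ''q'') I1))
           (RArr ''X'' (IPlus (IVar ''o'') (IVar ''t'')) (IVar ''e'')))))
     PSkip)"

definition flow_row :: prog where
  "flow_row = PFor ''e'' ''n'' (PIf (ILess I0 (IVar ''q''))
     (PIf (IEq (IVar ''e'') (IMinus (IVar ''q'') I1))
        (PR ''X'' (IVar ''R'') (IVar ''e'') (RConst 1))
        (PR ''X'' (IVar ''R'') (IVar ''e'') (RConst 0)) ;;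
      add_tail_flow)
     (PR ''X'' (IVar ''R'') (IVar ''e'') (RArr ''X'' (IPlus (IVar ''o'') (IVar ''h'')) (IVar ''e''))))"

definition relax :: prog where
  "relax = PI ''R'' (IPlus (IPlus (IVar ''o'') (IVar ''M'')) (IVar ''h'')) ;; PI ''q'' I0 ;;
     PR ''Y'' (IVar ''R'') I0 (RArr ''Y'' (IPlus (IVar ''o'') (IVar ''h'')) I0) ;;
     PR ''Y'' (IVar ''R'') I1 (RArr ''Y'' (IPlus (IVar ''o'') (IVar ''h'')) I1) ;;
     best_column ;; PA ''pol'' (IVar ''R'') (IVar ''q'') ;; flow_row"

definition sweep :: prog where
  "sweep = PFor ''h'' ''M'' relax ;; PI ''o'' (IPlus (IVar ''o'') (IVar ''M''))"

definition iteration :: prog where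
  "iteration = PFor ''k'' ''M'' sweep"

definition farkas_out :: prog where
  "farkas_out = PR ''be'' I0 I0 (RConst 0) ;;
     PFor ''v'' ''m'' (PR ''z'' (IVar ''v'') I0 (RArr ''Y'' (IPlus (IVar ''o'') (IVar ''v'')) I0) ;;
       PR ''be'' I0 I0 (RPlus (cell ''be'') (RTimes (item ''b'' ''v'') (item ''z'' ''v''))))"

definition add_flow :: prog where
  "add_flow = PFor ''v'' ''m'' (PR ''x'' (IVar ''e'') I0 (RPlus (item ''x'' ''e'')
     (RTimes (item ''b'' ''v'') (RArr ''X'' (IPlus (IVar ''o'') (IVar ''v'')) (IVar ''e'')))))"

definition flow_out :: prog where
  "flow_out = PFor ''e'' ''n'' (PR ''x'' (IVar ''e'') I0 (RConst 0) ;; add_flow)"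

text \<open>\<open>K / d\<close> is the least admissible value of the large number \<open>\<omega>\<close> in the dual solution \<open>B * \<omega> + V\<close>,
  a maximum of quotients that is found by cross multiplication.\<close>

definition slack :: prog where
  "slack = PR ''D'' I0 I0 (RConst 0) ;; PR ''G'' I0 I0 (RMinus (RConst 0) (item ''c'' ''j'')) ;;
     PFor ''t'' ''m''
       (PR ''D'' I0 I0 (RMinus (cell ''D'') (RTimes (entry ''t'' (IVar ''j''))
          (RArr ''Y'' (IPlus (IVar ''o'') (IVar ''t'')) I0))) ;;
        PR ''G'' I0 I0 (RPlus (cell ''G'') (RTimes (entry ''t'' (IVar ''j''))
          (RArr ''Y'' (IPlus (IVar ''o'') (IVar ''t'')) I1))))"

definition scale :: prog where
  "scale = PR ''d'' I0 I0 (RConst 1) ;; PR ''K'' I0 I0 (RConst 0) ;;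
     PFor ''j'' ''n'' (slack ;;
       PIf (RLess (RTimes (cell ''K'') (cell ''D'')) (RTimes (cell ''G'') (cell ''d'')))
         (PR ''K'' I0 I0 (cell ''G'') ;; PR ''d'' I0 I0 (cell ''D'')) PSkip)"

definition dual_out :: prog where
  "dual_out = PFor ''v'' ''m'' (PR ''y'' (IVar ''v'') I0
     (RPlus (RTimes (cell ''d'') (RArr ''Y'' (IPlus (IVar ''o'') (IVar ''v'')) I1))
            (RTimes (cell ''K'') (RArr ''Y'' (IPlus (IVar ''o'') (IVar ''v'')) I0))))"

definition row_drops :: "iexp \<Rightarrow> vname \<Rightarrow> bexp" where
  "row_drops l v = LexLess (RArr ''Y'' (IPlus l (IVar v)) I0) (RArr ''Y'' (IPlus l (IVar v)) I1)
     (RArr ''Y'' (IPlus (IMinus l (IVar ''M'')) (IVar v)) I0)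
     (RArr ''Y'' (IPlus (IMinus l (IVar ''M'')) (IVar v)) I1)"

definition unstable :: prog where
  "unstable = PI ''f'' I0 ;; PFor ''v'' ''m'' (PIf (row_drops (IVar ''o'') ''v'')
     (PI ''f'' I1 ;; PI ''u'' (IVar ''v'')) PSkip)"

definition next_vertex :: prog where
  "next_vertex = PFor ''t'' ''m'' (PIf (And (RLess (entry ''t'' (IVar ''q'')) (RConst 0))
     (row_drops (IMinus (IVar ''l'') (IVar ''M'')) ''t'')) (PI ''w'' (IVar ''t'')) PSkip)"

text \<open>In the last pass there is no lower level left and the vertex found is meaningless; it is
  never stored, as each pass stores its vertex before searching for the next one.\<close>

definition descend :: prog where
  "descend = PI ''l'' (IVar ''o'') ;; PFor ''k'' ''M''
     (PA ''chv'' (IVar ''k'') (IVar ''u'') ;; PA ''chn'' (IVar ''k'') (IPlus (IVar ''l'') (IVar ''u'')) ;;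
      PI ''q'' (IMinus (IArr ''pol'' (IPlus (IVar ''l'') (IVar ''u''))) I1) ;;
      next_vertex ;; PI ''u'' (IVar ''w'') ;; PI ''l'' (IMinus (IVar ''l'') (IVar ''M'')))"

definition repeated_later :: prog where
  "repeated_later = PFor ''j'' ''M'' (PIf (And (ILess (IVar ''i'') (IVar ''j''))
       (IEq (IArr ''chv'' (IVar ''i'')) (IArr ''chv'' (IVar ''j''))))
     (PI ''p1'' (IArr ''chn'' (IVar ''i'')) ;; PI ''p0'' (IArr ''chn'' (IVar ''j''))) PSkip)"

definition repeated :: prog where
  "repeated = PFor ''i'' ''M'' repeated_later"

text \<open>Runs after \<open>repeated\<close> and overwrites its choice of rows. Row
  \<open>m\<close> is the root on level 0, whose flow is zero, so the ray of the root is also a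
  difference of two rows.\<close>

definition root_check :: prog where
  "root_check = PIf (RLess (RArr ''Y'' (IPlus (IVar ''o'') (IVar ''m'')) I1) (RConst 0))
     (PI ''f'' I1 ;; PI ''p1'' (IPlus (IVar ''o'') (IVar ''m'')) ;; PI ''p0'' (IVar ''m'')) PSkip"

definition ray_out :: prog where
  "ray_out = PFor ''e'' ''n'' (PR ''r'' (IVar ''e'') I0
     (RMinus (RArr ''X'' (IVar ''p1'') (IVar ''e'')) (RArr ''X'' (IVar ''p0'') (IVar ''e''))))"

definition verdict :: prog where
  "verdict = PIf (RLess (RConst 0) (cell ''be''))
     (PIf (ILess I0 (IVar ''f'')) (PI ''case'' (IConst 4)) (PI ''case'' (IConst 2)))
     (PIf (ILess I0 (IVar ''f'')) (PI ''case'' (IConst 3)) (PI ''case'' (IConst 1)))"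

text \<open>All candidates are computed in every case, even where they certify nothing; only
  \<open>verdict\<close> decides which of them form the output.\<close>

definition leontief_lp :: prog where
  "leontief_lp = heads ;; start ;; iteration ;; farkas_out ;; flow_out ;; scale ;; dual_out ;;
     unstable ;; descend ;; repeated ;; root_check ;; ray_out ;; verdict"

text \<open>The write sets of all phases, computed once: with them the simplifier discharges the
  side conditions of the frame rules.\<close>

lemma written [simp]:
  "regs find_head = {''i''}" "iarrs find_head = {''hd''}" "rarrs find_head = {}"
  "regs heads = {''i'', ''j''}" "iarrs heads = {''hd''}" "rarrs heads = {}"
  "regs start = {''h''}" "iarrs start = {}" "rarrs start = {''Y''}"
  "regs column_value = {''t''}" "iarrs column_value = {}" "rarrs column_value = {''S''}"
  "regs best_column = {''j'', ''t'', ''q''}" "iarrs best_column = {}" "rarrs best_column = {''S'', ''Y''}"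
  "regs add_tail_flow = {''t''}" "iarrs add_tail_flow = {}" "rarrs add_tail_flow = {''X''}"
  "regs flow_row = {''e'', ''t''}" "iarrs flow_row = {}" "rarrs flow_row = {''X''}"
  "regs relax = {''R'', ''q'', ''j'', ''t'', ''e''}" "iarrs relax = {''pol''}"
  "rarrs relax = {''Y'', ''S'', ''X''}"
  "regs sweep = {''h'', ''o'', ''R'', ''q'', ''j'', ''t'', ''e''}" "iarrs sweep = {''pol''}"
  "rarrs sweep = {''Y'', ''S'', ''X''}"
  "regs iteration = {''k'', ''h'', ''o'', ''R'', ''q'', ''j'', ''t'', ''e''}" "iarrs iteration = {''pol''}"
  "rarrs iteration = {''Y'', ''S'', ''X''}"
  "regs farkas_out = {''v''}" "iarrs farkas_out = {}" "rarrs farkas_out = {''be'', ''z''}"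
  "regs add_flow = {''v''}" "iarrs add_flow = {}" "rarrs add_flow = {''x''}"
  "regs flow_out = {''e'', ''v''}" "iarrs flow_out = {}" "rarrs flow_out = {''x''}"
  "regs slack = {''t''}" "iarrs slack = {}" "rarrs slack = {''D'', ''G''}"
  "regs scale = {''j'', ''t''}" "iarrs scale = {}" "rarrs scale = {''d'', ''K'', ''D'', ''G''}"
  "regs dual_out = {''v''}" "iarrs dual_out = {}" "rarrs dual_out = {''y''}"
  "regs unstable = {''f'', ''v'', ''u''}" "iarrs unstable = {}" "rarrs unstable = {}"
  "regs next_vertex = {''t'', ''w''}" "iarrs next_vertex = {}" "rarrs next_vertex = {}"
  "regs descend = {''l'', ''k'', ''q'', ''t'', ''w'', ''u''}" "iarrs descend = {''chv'', ''chn''}"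
  "rarrs descend = {}"
  "regs repeated_later = {''j'', ''p1'', ''p0''}" "iarrs repeated_later = {}" "rarrs repeated_later = {}"
  "regs repeated = {''i'', ''j'', ''p1'', ''p0''}" "iarrs repeated = {}" "rarrs repeated = {}"
  "regs root_check = {''f'', ''p1'', ''p0''}" "iarrs root_check = {}" "rarrs root_check = {}"
  "regs ray_out = {''e''}" "iarrs ray_out = {}" "rarrs ray_out = {''r''}"
  "regs verdict = {''case''}" "iarrs verdict = {}" "rarrs verdict = {}"
  by (auto simp: find_head_def heads_def start_def column_value_def best_column_def add_tail_flow_def flow_row_def relax_def sweep_def
      iteration_def farkas_out_def add_flow_def flow_out_def slack_def scale_def dual_out_def unstable_def
      next_vertex_def descend_def repeated_later_def repeated_def root_check_def ray_out_def verdict_def)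

text \<open>The deepest nests run over rounds, vertices, columns and tail elements, that is, three
  loops of length about m and one of length n. The exponents are written as successors so that each
  loop rule removes one.\<close>

lemma leontief_lp_time: "runs_in leontief_lp 3 1"
proof -
  have "runs_in leontief_lp (Suc (Suc (Suc 0))) (Suc 0)"
    unfolding leontief_lp_def find_head_def heads_def start_def column_value_def best_column_def add_tail_flow_def flow_row_def relax_def
      sweep_def iteration_def farkas_out_def add_flow_def flow_out_def slack_def scale_def dual_out_def unstable_def
      next_vertex_def descend_def repeated_later_def repeated_def root_check_def ray_out_def verdict_def
    by (intro runs_in_Seq runs_in_If runs_in_atom runs_in_For_m runs_in_For_M runs_in_For_n)
  then show ?thesis by (simp add: numeral_eq_Suc)
qed

lemma leontief_lp_wf:
  "fresh_counters leontief_lp" "bounds leontief_lp \<subseteq> {''m'', ''n'', ''M''}"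
  "{''m'', ''n'', ''M''} \<inter> regs leontief_lp = {}"
  by (auto simp: leontief_lp_def)
     (auto simp: find_head_def heads_def start_def column_value_def best_column_def add_tail_flow_def flow_row_def relax_def sweep_def
      iteration_def farkas_out_def add_flow_def flow_out_def slack_def scale_def dual_out_def unstable_def
      next_vertex_def descend_def repeated_later_def repeated_def root_check_def ray_out_def verdict_def)


section \<open>Correctness of the program\<close>

lemma lex_less_trans: "lex_less a b c d \<Longrightarrow> lex_less c d e f \<Longrightarrow> lex_less a b e f"
  by (auto simp: lex_less_def)

lemma lex_less_trans_not: "\<not> lex_less a b c d \<Longrightarrow> lex_less e f c d \<Longrightarrow> \<not> lex_less a b e f"
  by (auto simp: lex_less_def)

lemma lex_less_irrefl: "\<not> lex_less a b a b"
  by (simp add: lex_less_def)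

locale lp_input = gainfree_leontief +
  fixes b c :: "nat \<Rightarrow> real"
begin

text \<open>The memory that every phase may rely on: the sizes and the input, none of which is ever
  overwritten.\<close>

definition ready :: "state \<Rightarrow> bool" where
  "ready s \<longleftrightarrow> ivar s ''m'' = m \<and> ivar s ''n'' = n \<and> ivar s ''M'' = Suc m \<and>
     (\<forall>i<m. \<forall>j<n. rarr s ''A'' i j = A $$ (i, j)) \<and>
     (\<forall>i<m. rarr s ''b'' i 0 = b i) \<and> (\<forall>j<n. rarr s ''c'' j 0 = c j)"

lemma readyD:
  assumes "ready s"
  shows "ivar s ''m'' = m" "ivar s ''n'' = n" "ivar s ''M'' = Suc m"
    "i < m \<Longrightarrow> j < n \<Longrightarrow> rarr s ''A'' i j = A $$ (i, j)"
    "i < m \<Longrightarrow> rarr s ''b'' i 0 = b i" "j < n \<Longrightarrow> rarr s ''c'' j 0 = c j"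
  using assms by (auto simp: ready_def)

lemma ready_frame:
  assumes "ready s" "frame p s t" "''m'' \<notin> regs p" "''n'' \<notin> regs p" "''M'' \<notin> regs p"
    "''A'' \<notin> rarrs p" "''b'' \<notin> rarrs p" "''c'' \<notin> rarrs p"
  shows "ready t"
  using assms by (simp add: ready_def frame_def)

lemma ready_cong:
  assumes "ready s" "ivar t ''m'' = ivar s ''m''" "ivar t ''n'' = ivar s ''n''" "ivar t ''M'' = ivar s ''M''"
    "rarr t ''A'' = rarr s ''A''" "rarr t ''b'' = rarr s ''b''" "rarr t ''c'' = rarr s ''c''"
  shows "ready t"
  using assms by (simp add: ready_def)

lemma heads_correct:
  assumes s: "ready s"
  shows "\<forall>j<n. iarr (sem heads s) ''hd'' j = col_head j"
proof -
  let ?I = "\<lambda>k u. \<forall>j<k. iarr u ''hd'' j = col_head j"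
  show ?thesis
    unfolding heads_def
  proof (rule sem_For[where I = ?I and K = n], goal_cases)
    case (4 k t)
    note k = 4(1,2) and fr = 4(3) and I = 4(4)
    have t: "ready t" by (rule ready_frame[OF s fr]) simp_all
    let ?t = "sem (PA ''hd'' (IVar ''j'') (IVar ''m'')) t"
    let ?J = "\<lambda>i u. (\<forall>j<k. iarr u ''hd'' j = col_head j) \<and>
      iarr u ''hd'' k = (if col_head k < i then col_head k else m)"
    have "?J m (sem find_head ?t)"
      unfolding find_head_def
    proof (rule sem_For[where I = ?J and K = m], goal_cases)
      case 3 show ?case using I k readyD[OF t] by simp
    next
      case (4 i u)
      note i = 4(1,2) and fr = 4(3) and J = 4(4)
      have u: "ready u" by (rule ready_frame[OF _ fr]; (rule ready_cong[OF t])?) simp_all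
      have j: "ivar u ''j'' = k" using ivar_frame[OF fr, of "''j''"] k by simp
      have "A $$ (i, k) > 0 \<longleftrightarrow> col_head k = i"
        using col_headI[OF i(1) k(1)] entry_head[OF k(1)] i by auto
      then show ?case
        using J i j k readyD[OF u] by (auto simp: less_Suc_eq)
    qed (use readyD[OF t] in simp_all)
    then show ?case
      using col_head_le[OF k(1)] by (auto simp: less_Suc_eq)
  qed (use readyD[OF s] in simp_all)
qed

lemma start_correct:
  assumes s: "ready s"
  shows "rarr (sem start s) ''Y'' i j = (if i < m \<and> j = 0 then 1 else rarr s ''Y'' i j)"
proof -
  let ?I = "\<lambda>k u. \<forall>i j. rarr u ''Y'' i j = (if i < k \<and> j = 0 then 1 else rarr s ''Y'' i j)"
  have "?I m (sem start s)"
    unfolding start_def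
  proof (rule sem_For[where I = ?I and K = m], goal_cases)
    case (4 k t)
    then show ?case
      by (auto simp: less_Suc_eq)
  qed (use readyD[OF s] in simp_all)
  then show ?thesis by blast
qed

section \<open>The relaxation of a vertex\<close>

definition col_val :: "(nat \<Rightarrow> nat \<Rightarrow> real) \<Rightarrow> nat \<Rightarrow> nat \<Rightarrow> real" where
  "col_val Y o' j = (\<Sum>t<m. coef t j * Y (o' + t) 0)"

definition col_cost :: "(nat \<Rightarrow> nat \<Rightarrow> real) \<Rightarrow> nat \<Rightarrow> nat \<Rightarrow> real" where
  "col_cost Y o' j = c j + (\<Sum>t<m. coef t j * Y (o' + t) 1)"

lemma column_value_correct:
  assumes s: "ready s" and j: "ivar s ''j'' = j" "j < n"
  shows "rarr (sem column_value s) ''S'' 0 0 = col_val (rarr s ''Y'') (ivar s ''o'') j"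
    and "rarr (sem column_value s) ''S'' 0 (Suc 0) = col_cost (rarr s ''Y'') (ivar s ''o'') j"
proof -
  let ?Y = "rarr s ''Y''" and ?o = "ivar s ''o''"
  let ?I = "\<lambda>k u. rarr u ''S'' 0 0 = (\<Sum>t<k. coef t j * ?Y (?o + t) 0) \<and>
    rarr u ''S'' 0 (Suc 0) = c j + (\<Sum>t<k. coef t j * ?Y (?o + t) 1)"
  have "?I m (sem column_value s)"
    unfolding column_value_def sem.simps(5)
  proof (rule sem_For[where I = ?I and K = m], goal_cases)
    case (4 k u)
    note k = 4(1,2) and fr = 4(3) and I = 4(4)
    have u: "ready u" by (rule ready_frame[OF _ fr]; (rule ready_cong[OF s])?) simp_all
    have "ivar u ''j'' = j" "ivar u ''o'' = ?o" "rarr u ''Y'' = ?Y"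
      using ivar_frame[OF fr, of "''j''"] ivar_frame[OF fr, of "''o''"] rarr_frame[OF fr, of "''Y''"] j
      by simp_all
    then show ?case
      using I k j readyD[OF u] by (simp add: coef_def)
  qed (use readyD[OF s] j in simp_all)
  then show "rarr (sem column_value s) ''S'' 0 0 = col_val ?Y ?o j"
    and "rarr (sem column_value s) ''S'' 0 (Suc 0) = col_cost ?Y ?o j"
    by (simp_all add: col_val_def col_cost_def)
qed

lemma col_val_cong:
  assumes "\<And>t. t < m \<Longrightarrow> Y (o' + t) = Y' (o' + t)"
  shows "col_val Y o' j = col_val Y' o' j" "col_cost Y o' j = col_cost Y' o' j"
  using assms by (simp_all add: col_val_def col_cost_def)

text \<open>Invariant of the loop over the columns after \<open>k\<close> of them:
  \<open>a0\<close>, \<open>a1\<close> is the value on the previous level, \<open>y0\<close>,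
  \<open>y1\<close> the best one so far, and \<open>q\<close> encodes its column.\<close>

definition best :: "(nat \<Rightarrow> nat \<Rightarrow> real) \<Rightarrow> nat \<Rightarrow> nat \<Rightarrow> nat \<Rightarrow> nat \<Rightarrow> real \<Rightarrow> real \<Rightarrow> real \<Rightarrow> real \<Rightarrow> bool" where
  "best Y o' h k q a0 a1 y0 y1 \<longleftrightarrow> (q = 0 \<longrightarrow> y0 = a0 \<and> y1 = a1) \<and>
     (\<forall>j. q = Suc j \<longrightarrow> j < k \<and> col_head j = h \<and> y0 = col_val Y o' j \<and> y1 = col_cost Y o' j \<and>
        lex_less y0 y1 a0 a1) \<and>
     (\<forall>j<k. col_head j = h \<longrightarrow> \<not> lex_less (col_val Y o' j) (col_cost Y o' j) y0 y1)"

lemma best_cong: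
  assumes "\<And>t. t < m \<Longrightarrow> Y (o' + t) = Y' (o' + t)"
  shows "best Y o' = best Y' o'"
proof -
  have "col_val Y o' = col_val Y' o'" "col_cost Y o' = col_cost Y' o'"
    using col_val_cong[of Y o' Y'] assms by (simp_all add: fun_eq_iff)
  then show ?thesis by (simp add: best_def fun_eq_iff)
qed

lemma best_Suc_keep:
  assumes "best Y o' h k q a0 a1 y0 y1"
    and "col_head k = h \<Longrightarrow> \<not> lex_less (col_val Y o' k) (col_cost Y o' k) y0 y1"
  shows "best Y o' h (Suc k) q a0 a1 y0 y1"
  using assms by (auto simp: best_def less_Suc_eq)

lemma best_Suc_update:
  assumes B: "best Y o' h k q a0 a1 y0 y1" and k: "col_head k = h"
    and lt: "lex_less (col_val Y o' k) (col_cost Y o' k) y0 y1"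
  shows "best Y o' h (Suc k) (Suc k) a0 a1 (col_val Y o' k) (col_cost Y o' k)"
proof -
  have "lex_less (col_val Y o' k) (col_cost Y o' k) a0 a1"
    using B lt lex_less_trans by (cases q) (auto simp: best_def)
  moreover have "\<not> lex_less (col_val Y o' j) (col_cost Y o' j) (col_val Y o' k) (col_cost Y o' k)"
    if "j < k" "col_head j = h" for j
    by (rule lex_less_trans_not[OF _ lt]) (use B that in \<open>auto simp: best_def\<close>)
  ultimately show ?thesis using k by (auto simp: best_def less_Suc_eq lex_less_irrefl)
qed

text \<open>The assumption on \<open>R\<close> places the written row beyond the \<open>m\<close>
  rows from which column values are computed, so these do not change during the loop.\<close>

lemma best_column_correct:
  assumes s: "ready s" and hd: "\<forall>j<n. iarr s ''hd'' j = col_head j" and q: "ivar s ''q'' = 0"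
    and R: "ivar s ''o'' + m \<le> ivar s ''R''"
  defines "Y \<equiv> rarr s ''Y''" and "R \<equiv> ivar s ''R''" and "s' \<equiv> sem best_column s"
  shows "best Y (ivar s ''o'') (ivar s ''h'') n (ivar s' ''q'') (Y R 0) (Y R 1)
      (rarr s' ''Y'' R 0) (rarr s' ''Y'' R 1)"
    and "r \<noteq> R \<Longrightarrow> rarr s' ''Y'' r = Y r"
proof -
  let ?o = "ivar s ''o''" and ?h = "ivar s ''h''"
  let ?I = "\<lambda>k u. best Y ?o ?h k (ivar u ''q'') (Y R 0) (Y R 1) (rarr u ''Y'' R 0) (rarr u ''Y'' R 1) \<and>
    (\<forall>r. r \<noteq> R \<longrightarrow> rarr u ''Y'' r = Y r)"
  have "?I n s'"
    unfolding s'_def best_column_def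
  proof (rule sem_For[where I = ?I and K = n], goal_cases)
    case 3 show ?case using q by (simp add: best_def Y_def)
  next
    case (4 k t)
    note k = 4(1,2) and fr = 4(3) and I = 4(4)
    have t: "ready t" by (rule ready_frame[OF s fr]) simp_all
    have f: "ivar t ''o'' = ?o" "ivar t ''h'' = ?h" "ivar t ''R'' = R" "iarr t ''hd'' = iarr s ''hd''"
      using ivar_frame[OF fr, of "''o''"] ivar_frame[OF fr, of "''h''"] ivar_frame[OF fr, of "''R''"]
        iarr_frame[OF fr, of "''hd''"]
      by (simp_all add: R_def)
    have "rarr t ''Y'' (?o + i) = Y (?o + i)" if "i < m" for i
      using I R that by (simp add: R_def)
    note cv = col_val_cong[where Y = "rarr t ''Y''" and Y' = Y and o' = ?o, OF this]
    let ?t = "sem column_value t"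
    have g: "rarr ?t ''S'' 0 0 = col_val Y ?o k" "rarr ?t ''S'' 0 (Suc 0) = col_cost Y ?o k"
      using column_value_correct[OF t k(2,1)] f cv by auto
    show ?case
    proof (cases "col_head k = ?h")
      case False
      then show ?thesis using I k f hd best_Suc_keep by simp
    next
      case True
      show ?thesis
      proof (cases "lex_less (col_val Y ?o k) (col_cost Y ?o k) (rarr t ''Y'' R 0) (rarr t ''Y'' R 1)")
        case lt: True
        show ?thesis
          using True lt I k f hd g best_Suc_update[OF conjunct1[OF I] True lt]
          by (simp add: ivar_sem rarr_sem)
      next
        case nlt: False
        show ?thesis
          using True nlt I k f hd g best_Suc_keep[OF conjunct1[OF I] nlt]
          by (simp add: ivar_sem rarr_sem)
      qed
    qed
  qed (use readyD[OF s] in simp_all)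
  then show "best Y ?o ?h n (ivar s' ''q'') (Y R 0) (Y R 1) (rarr s' ''Y'' R 0) (rarr s' ''Y'' R 1)"
    and "r \<noteq> R \<Longrightarrow> rarr s' ''Y'' r = Y r" by auto
qed

definition row_flow :: "(nat \<Rightarrow> nat \<Rightarrow> real) \<Rightarrow> nat \<Rightarrow> nat \<Rightarrow> nat \<Rightarrow> nat \<Rightarrow> real" where
  "row_flow X o' h q e = (case q of 0 \<Rightarrow> X (o' + h) e
     | Suc j \<Rightarrow> (if e = j then 1 else 0) + (\<Sum>t<m. coef t j * X (o' + t) e))"

lemma flow_row_correct:
  assumes s: "ready s" and q: "ivar s ''q'' \<le> n"
    and R: "ivar s ''o'' + m \<le> ivar s ''R''" "ivar s ''o'' + ivar s ''h'' < ivar s ''R''"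
  defines "X \<equiv> rarr s ''X''" and "R \<equiv> ivar s ''R''" and "s' \<equiv> sem flow_row s"
  shows "e < n \<Longrightarrow> rarr s' ''X'' R e = row_flow X (ivar s ''o'') (ivar s ''h'') (ivar s ''q'') e"
    and "r \<noteq> R \<Longrightarrow> rarr s' ''X'' r = X r"
proof -
  let ?o = "ivar s ''o''" and ?h = "ivar s ''h''" and ?q = "ivar s ''q''"
  let ?I = "\<lambda>k u. (\<forall>e<k. rarr u ''X'' R e = row_flow X ?o ?h ?q e) \<and>
    (\<forall>r. r \<noteq> R \<longrightarrow> rarr u ''X'' r = X r)"
  have "?I n s'"
    unfolding s'_def flow_row_def
  proof (rule sem_For[where I = ?I and K = n], goal_cases)
    case 3 show ?case by (simp add: X_def)
  next
    case (4 k t)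
    note k = 4(1,2) and fr = 4(3) and I = 4(4)
    have t: "ready t" by (rule ready_frame[OF s fr]) simp_all
    have f: "ivar t ''o'' = ?o" "ivar t ''h'' = ?h" "ivar t ''R'' = R" "ivar t ''q'' = ?q"
      using ivar_frame[OF fr, of "''o''"] ivar_frame[OF fr, of "''h''"] ivar_frame[OF fr, of "''R''"]
        ivar_frame[OF fr, of "''q''"]
      by (simp_all add: R_def)
    show ?case
    proof (cases ?q)
      case 0
      then show ?thesis using I f k R by (auto simp: row_flow_def R_def less_Suc_eq)
    next
      case (Suc j)
      with q have j: "j < n" by simp
      let ?p = "PIf (IEq (IVar ''e'') (IMinus (IVar ''q'') I1))
        (PR ''X'' (IVar ''R'') (IVar ''e'') (RConst 1))
        (PR ''X'' (IVar ''R'') (IVar ''e'') (RConst 0))"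
      let ?t = "sem ?p t"
      let ?J = "\<lambda>i u. (\<forall>e<k. rarr u ''X'' R e = row_flow X ?o ?h ?q e) \<and>
        (\<forall>r. r \<noteq> R \<longrightarrow> rarr u ''X'' r = X r) \<and>
        rarr u ''X'' R k = (if k = j then 1 else 0) + (\<Sum>t<i. coef t j * X (?o + t) k)"
      have "?J m (sem add_tail_flow ?t)"
        unfolding add_tail_flow_def
      proof (rule sem_For[where I = ?J and K = m], goal_cases)
        case 3 show ?case using I f k Suc by auto
      next
        case (4 i u)
        note i = 4(1,2) and fr = 4(3) and J = 4(4)
        have u: "ready u" by (rule ready_frame[OF _ fr]; (rule ready_cong[OF t])?) simp_all
        have g: "ivar u ''o'' = ?o" "ivar u ''R'' = R" "ivar u ''q'' = Suc j" "ivar u ''e'' = k"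
          using ivar_frame[OF fr, of "''o''"] ivar_frame[OF fr, of "''R''"]
            ivar_frame[OF fr, of "''q''"] ivar_frame[OF fr, of "''e''"] f k Suc
          by simp_all
        have "rarr u ''X'' (?o + i) = X (?o + i)" using J R i by (simp add: R_def)
        then show ?case
          using J g i j readyD[OF u] by (auto simp: coef_def)
      qed (use readyD[OF t] in simp_all)
      then show ?thesis using f Suc
        by (auto simp: row_flow_def less_Suc_eq)
    qed
  qed (use readyD[OF s] in simp_all)
  then show "e < n \<Longrightarrow> rarr s' ''X'' R e = row_flow X ?o ?h ?q e"
    and "r \<noteq> R \<Longrightarrow> rarr s' ''X'' r = X r" by auto
qed

definition relaxed :: "(nat \<Rightarrow> nat \<Rightarrow> real) \<Rightarrow> (nat \<Rightarrow> nat \<Rightarrow> real) \<Rightarrow> (nat \<Rightarrow> nat) \<Rightarrow> nat \<Rightarrow> nat \<Rightarrow> bool" where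
  "relaxed Y X pol o' h \<longleftrightarrow> (let R = o' + Suc m + h in
     best Y o' h n (pol R) (Y (o' + h) 0) (Y (o' + h) 1) (Y R 0) (Y R 1) \<and>
     (\<forall>e<n. X R e = row_flow X o' h (pol R) e))"

text \<open>A relaxed row refers to no row above itself, so it survives all later steps, which write
  higher rows only.\<close>

lemma relaxed_cong:
  assumes "relaxed Y X pol o' h"
    and "\<And>r. r \<le> o' + Suc m + h \<Longrightarrow> Y' r = Y r \<and> X' r = X r \<and> pol' r = pol r" and "h \<le> m"
  shows "relaxed Y' X' pol' o' h"
proof -
  have "best Y' o' = best Y o'"
    by (rule best_cong) (use assms(2) in simp)
  moreover have "row_flow X' o' h q e = row_flow X o' h q e" for q e
    using assms(2,3) by (simp add: row_flow_def split: nat.split)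
  ultimately show ?thesis using assms unfolding relaxed_def by simp
qed

lemma relax_correct:
  assumes s: "ready s" and hd: "\<forall>j<n. iarr s ''hd'' j = col_head j"
    and h: "ivar s ''h'' = h" "h \<le> m" and o': "ivar s ''o'' = o'"
  defines "s' \<equiv> sem relax s"
  shows "relaxed (rarr s' ''Y'') (rarr s' ''X'') (iarr s' ''pol'') o' h"
    and "r \<noteq> o' + Suc m + h \<Longrightarrow> rarr s' ''Y'' r = rarr s ''Y'' r \<and>
      rarr s' ''X'' r = rarr s ''X'' r \<and> iarr s' ''pol'' r = iarr s ''pol'' r"
proof -
  let ?R = "o' + Suc m + h"
  define s1 where "s1 = sem (PI ''R'' (IPlus (IPlus (IVar ''o'') (IVar ''M'')) (IVar ''h'')) ;; PI ''q'' I0 ;;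
     PR ''Y'' (IVar ''R'') I0 (RArr ''Y'' (IPlus (IVar ''o'') (IVar ''h'')) I0) ;;
     PR ''Y'' (IVar ''R'') I1 (RArr ''Y'' (IPlus (IVar ''o'') (IVar ''h'')) I1)) s"
  have s1: "ready s1" unfolding s1_def by (rule ready_cong[OF s]) auto
  have f1: "ivar s1 ''o'' = o'" "ivar s1 ''h'' = h" "ivar s1 ''R'' = ?R" "ivar s1 ''q'' = 0"
    "iarr s1 = iarr s" "rarr s1 ''X'' = rarr s ''X''"
    and Y1: "\<And>r. r \<noteq> ?R \<Longrightarrow> rarr s1 ''Y'' r = rarr s ''Y'' r"
    "rarr s1 ''Y'' ?R 0 = rarr s ''Y'' (o' + h) 0" "rarr s1 ''Y'' ?R 1 = rarr s ''Y'' (o' + h) 1"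
    using h o' readyD[OF s] by (simp_all add: s1_def)
  define s2 where "s2 = sem best_column s1"
  have s2: "ready s2" unfolding s2_def by (rule ready_frame[OF s1 frame_sem]) simp_all
  have best: "best (rarr s1 ''Y'') o' h n (ivar s2 ''q'') (rarr s ''Y'' (o' + h) 0) (rarr s ''Y'' (o' + h) 1)
      (rarr s2 ''Y'' ?R 0) (rarr s2 ''Y'' ?R 1)"
    and Y2: "\<And>r. r \<noteq> ?R \<Longrightarrow> rarr s2 ''Y'' r = rarr s1 ''Y'' r"
    using best_column_correct[OF s1] hd f1 Y1 by (simp_all add: s2_def)
  have f2: "ivar s2 ''o'' = o'" "ivar s2 ''h'' = h" "ivar s2 ''R'' = ?R"
    "iarr s2 = iarr s" "rarr s2 ''X'' = rarr s ''X''"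
    using f1 by (simp_all add: s2_def ivar_sem rarr_sem fun_eq_iff iarr_sem)
  define s3 where "s3 = sem (PA ''pol'' (IVar ''R'') (IVar ''q'')) s2"
  have s3: "ready s3" unfolding s3_def by (rule ready_cong[OF s2]) auto
  have f3: "ivar s3 = ivar s2" "rarr s3 = rarr s2" "iarr s3 ''pol'' = (iarr s ''pol'')(?R := ivar s2 ''q'')"
    using f2 by (simp_all add: s3_def)
  have s': "s' = sem flow_row s3"
    by (simp add: s'_def relax_def s1_def s2_def s3_def)
  have q: "ivar s2 ''q'' \<le> n" using best by (cases "ivar s2 ''q''") (auto simp: best_def)
  have X: "\<And>e. e < n \<Longrightarrow> rarr s' ''X'' ?R e = row_flow (rarr s ''X'') o' h (ivar s2 ''q'') e"
    "\<And>r. r \<noteq> ?R \<Longrightarrow> rarr s' ''X'' r = rarr s ''X'' r"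
    using flow_row_correct[OF s3] q f2 f3 by (simp_all add: s')
  have Y: "rarr s' ''Y'' = rarr s2 ''Y''" and pol: "iarr s' ''pol'' = (iarr s ''pol'')(?R := ivar s2 ''q'')"
    using f3 by (simp_all add: s' rarr_sem iarr_sem)
  have "row_flow (rarr s' ''X'') o' h q e = row_flow (rarr s ''X'') o' h q e" for q e
    using X(2) h by (simp add: row_flow_def split: nat.split)
  moreover have "best (rarr s2 ''Y'') o' = best (rarr s1 ''Y'') o'"
    by (rule best_cong) (simp add: Y2)
  moreover have "rarr s' ''Y'' (o' + h) = rarr s ''Y'' (o' + h)" using Y Y1 Y2 by simp
  ultimately show "relaxed (rarr s' ''Y'') (rarr s' ''X'') (iarr s' ''pol'') o' h"
    using best X(1) unfolding relaxed_def by (simp add: Y pol)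
  show "r \<noteq> ?R \<Longrightarrow> rarr s' ''Y'' r = rarr s ''Y'' r \<and>
      rarr s' ''X'' r = rarr s ''X'' r \<and> iarr s' ''pol'' r = iarr s ''pol'' r"
    using Y Y1 Y2 X pol by simp
qed

definition level_done :: "state \<Rightarrow> nat \<Rightarrow> nat \<Rightarrow> bool" where
  "level_done s o' h \<longleftrightarrow> relaxed (rarr s ''Y'') (rarr s ''X'') (iarr s ''pol'') o' h"

definition rows_agree :: "state \<Rightarrow> state \<Rightarrow> nat \<Rightarrow> bool" where
  "rows_agree s t N \<longleftrightarrow> (\<forall>r<N. rarr t ''Y'' r = rarr s ''Y'' r \<and> rarr t ''X'' r = rarr s ''X'' r \<and>
     iarr t ''pol'' r = iarr s ''pol'' r)"

lemma level_done_agree: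
  "level_done s o' h \<Longrightarrow> rows_agree s t N \<Longrightarrow> o' + Suc m + h < N \<Longrightarrow> h \<le> m \<Longrightarrow> level_done t o' h"
  unfolding level_done_def rows_agree_def by (erule relaxed_cong) auto

lemma rows_agree_trans: "rows_agree s t N \<Longrightarrow> rows_agree t u L \<Longrightarrow> N \<le> L \<Longrightarrow> rows_agree s u N"
  by (simp add: rows_agree_def)

lemma sweep_correct:
  assumes s: "ready s" and hd: "\<forall>j<n. iarr s ''hd'' j = col_head j" and o': "ivar s ''o'' = o'"
  defines "s' \<equiv> sem sweep s"
  shows "\<forall>h\<le>m. level_done s' o' h" "rows_agree s s' (o' + Suc m)" "ivar s' ''o'' = o' + Suc m"
proof -
  let ?I = "\<lambda>k u. (\<forall>h<k. level_done u o' h) \<and> rows_agree s u (o' + Suc m)"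
  define s1 where "s1 = sem (PFor ''h'' ''M'' relax) s"
  have I: "?I (Suc m) s1"
    unfolding s1_def
  proof (rule sem_For[where I = ?I and K = "Suc m"], goal_cases)
    case 3 show ?case by (simp add: rows_agree_def)
  next
    case (4 k t)
    note k = 4(1,2) and fr = 4(3) and I = 4(4)
    have t: "ready t" by (rule ready_frame[OF s fr]) simp_all
    have "\<forall>j<n. iarr t ''hd'' j = col_head j" "ivar t ''o'' = o'"
      using hd o' iarr_frame[OF fr, of "''hd''"] ivar_frame[OF fr, of "''o''"] by simp_all
    note rc = relax_correct[OF t this(1) k(2) _ this(2)]
    let ?t = "sem relax t"
    have levels: "level_done ?t o' k" using rc(1) k by (simp add: level_done_def)
    have ag: "rows_agree t ?t (o' + Suc m + k)" using rc(2) k by (simp add: rows_agree_def)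
    have "level_done ?t o' h" if "h < Suc k" for h
    proof (cases "h = k")
      case False
      then show ?thesis using that I k by (intro level_done_agree[OF _ ag]) auto
    qed (use levels in simp)
    moreover have "rows_agree s ?t (o' + Suc m)" using I ag by (auto intro: rows_agree_trans)
    ultimately show ?case
      by (simp add: level_done_def rows_agree_def)
  qed (use readyD[OF s] in simp_all)
  have "ivar s1 ''o'' = o'" "ivar s1 ''M'' = Suc m"
    using o' readyD[OF s] by (simp_all add: s1_def ivar_sem del: sem.simps(7))
  moreover have "s' = sem (PI ''o'' (IPlus (IVar ''o'') (IVar ''M''))) s1"
    unfolding s'_def s1_def sweep_def by simp
  ultimately show "\<forall>h\<le>m. level_done s' o' h" "rows_agree s s' (o' + Suc m)" "ivar s' ''o'' = o' + Suc m"
    using I by (simp_all add: level_done_def rows_agree_def less_Suc_eq_le)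
qed

lemma iteration_correct:
  assumes s: "ready s" and hd: "\<forall>j<n. iarr s ''hd'' j = col_head j" and o': "ivar s ''o'' = 0"
  defines "s' \<equiv> sem iteration s"
  shows "\<forall>k\<le>m. \<forall>h\<le>m. level_done s' (k * Suc m) h" "rows_agree s s' (Suc m)"
    "ivar s' ''o'' = Suc m * Suc m"
proof -
  let ?I = "\<lambda>k u. (\<forall>i<k. \<forall>h\<le>m. level_done u (i * Suc m) h) \<and> rows_agree s u (Suc m) \<and>
    ivar u ''o'' = k * Suc m"
  have "?I (Suc m) s'"
    unfolding s'_def iteration_def
  proof (rule sem_For[where I = ?I and K = "Suc m"], goal_cases)
    case 3 show ?case using o' by (simp add: rows_agree_def)
  next
    case (4 k t)
    note k = 4(1,2) and fr = 4(3) and I = 4(4)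
    have t: "ready t" by (rule ready_frame[OF s fr]) simp_all
    have "\<forall>j<n. iarr t ''hd'' j = col_head j" using hd iarr_frame[OF fr, of "''hd''"] by simp
    note rc = sweep_correct[OF t this, of "k * Suc m"]
    let ?t = "sem sweep t"
    have levels: "\<forall>h\<le>m. level_done ?t (k * Suc m) h" and ag: "rows_agree t ?t (k * Suc m + Suc m)"
      and o2: "ivar ?t ''o'' = k * Suc m + Suc m" using rc I by blast+
    have "level_done ?t (i * Suc m) h" if "i < Suc k" "h \<le> m" for i h
    proof (cases "i = k")
      case False
      then have "Suc i * Suc m \<le> k * Suc m" using that by (intro mult_le_mono1) simp
      then have "i * Suc m + Suc m + h < k * Suc m + Suc m" using that by simp
      with False that I show ?thesis by (intro level_done_agree[OF _ ag]) auto
    qed (use levels that in simp)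
    moreover have "rows_agree s ?t (Suc m)" using I ag by (auto intro: rows_agree_trans)
    ultimately show ?case
      using o2 by (simp add: level_done_def rows_agree_def)
  qed (use readyD[OF s] in simp_all)
  then show "\<forall>k\<le>m. \<forall>h\<le>m. level_done s' (k * Suc m) h" "rows_agree s s' (Suc m)"
    "ivar s' ''o'' = Suc m * Suc m" by (simp_all add: less_Suc_eq_le)
qed

text \<open>Passage from the flat arrays to the abstract iteration, with row
  \<open>k * Suc m + h\<close> as vertex \<open>h\<close> on level \<open>k\<close>. The three
  clauses of \<open>best\<close> supply \<open>stay\<close>, \<open>move\<close> and
  \<open>least\<close>.\<close>

lemma value_iteration_levels:
  assumes base: "\<And>h. h \<le> m \<Longrightarrow> Y h 0 = (if h < m then 1 else 0)" "\<And>h. h \<le> m \<Longrightarrow> Y h 1 = 0"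
    "\<And>h e. h \<le> m \<Longrightarrow> e < n \<Longrightarrow> X h e = 0"
    and levels: "\<And>k h. k \<le> m \<Longrightarrow> h \<le> m \<Longrightarrow> relaxed Y X pol (k * Suc m) h"
  shows "value_iteration A m n c (\<lambda>k h. Y (k * Suc m + h) 0) (\<lambda>k h. Y (k * Suc m + h) 1)
    (\<lambda>k h. X (k * Suc m + h)) (\<lambda>k h. pol (k * Suc m + h))"
proof
  fix k h assume k: "k \<le> m" "h \<le> m"
  have R: "Suc k * Suc m + h = k * Suc m + Suc m + h" by simp
  note d = levels[OF k, unfolded relaxed_def Let_def best_def row_flow_def col_val_def col_cost_def]
  { assume "pol (Suc k * Suc m + h) = 0"
    then show "Y (Suc k * Suc m + h) 0 = Y (k * Suc m + h) 0 \<and>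
        Y (Suc k * Suc m + h) 1 = Y (k * Suc m + h) 1 \<and>
        (\<forall>e<n. X (Suc k * Suc m + h) e = X (k * Suc m + h) e)"
      using d unfolding R by simp }
  { fix j assume P: "pol (Suc k * Suc m + h) = Suc j"
    then have X: "\<forall>e<n. X (k * Suc m + Suc m + h) e =
        (if e = j then 1 else 0) + (\<Sum>t<m. coef t j * X (k * Suc m + t) e)"
      using conjunct2[OF d] unfolding R by simp
    show "j < n \<and> col_head j = h \<and>
      Y (Suc k * Suc m + h) 0 = (\<Sum>t<m. coef t j * Y (k * Suc m + t) 0) \<and>
      Y (Suc k * Suc m + h) 1 = c j + (\<Sum>t<m. coef t j * Y (k * Suc m + t) 1) \<and>
      (\<forall>e<n. X (Suc k * Suc m + h) e = (if e = j then 1 else 0) + (\<Sum>t<m. coef t j * X (k * Suc m + t) e)) \<and>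
      lex_less (Y (Suc k * Suc m + h) 0) (Y (Suc k * Suc m + h) 1) (Y (k * Suc m + h) 0) (Y (k * Suc m + h) 1)"
      using conjunct1[OF conjunct2[OF conjunct1[OF levels[OF k, unfolded relaxed_def Let_def],
          unfolded best_def col_val_def col_cost_def]], rule_format, OF P[unfolded R]] X
      unfolding R by blast }
next
  fix k j h assume k: "k \<le> m" "j < n" "col_head j = h"
  have R: "Suc k * Suc m + h = k * Suc m + Suc m + h" by simp
  have "h \<le> m" using k col_head_le by blast
  note d = levels[OF k(1) this, unfolded relaxed_def Let_def best_def row_flow_def col_val_def col_cost_def]
  then show "\<not> lex_less (\<Sum>t<m. coef t j * Y (k * Suc m + t) 0) (c j + (\<Sum>t<m. coef t j * Y (k * Suc m + t) 1))
        (Y (Suc k * Suc m + h) 0) (Y (Suc k * Suc m + h) 1)"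
    using k unfolding R by simp
qed (use base in simp_all)

section \<open>Reading off the candidates for z, x and y\<close>

lemma farkas_out_correct:
  assumes s: "ready s"
  defines "s' \<equiv> sem farkas_out s" and "Y \<equiv> rarr s ''Y''" and "o' \<equiv> ivar s ''o''"
  shows "\<forall>v<m. rarr s' ''z'' v 0 = Y (o' + v) 0" "rarr s' ''be'' 0 0 = (\<Sum>v<m. b v * Y (o' + v) 0)"
proof -
  let ?I = "\<lambda>k u. (\<forall>v<k. rarr u ''z'' v 0 = Y (o' + v) 0) \<and>
    rarr u ''be'' 0 0 = (\<Sum>v<k. b v * Y (o' + v) 0)"
  have "?I m s'"
    unfolding s'_def farkas_out_def sem.simps(5)
  proof (rule sem_For[where I = ?I and K = m], goal_cases)
    case (4 k u)
    note k = 4(1,2) and fr = 4(3) and I = 4(4)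
    have u: "ready u" by (rule ready_frame[OF _ fr]; (rule ready_cong[OF s])?) simp_all
    have "ivar u ''o'' = o'" "rarr u ''Y'' = Y"
      using ivar_frame[OF fr, of "''o''"] rarr_frame[OF fr, of "''Y''"] by (simp_all add: o'_def Y_def)
    then show ?case using I k readyD[OF u] by (auto simp: less_Suc_eq)
  qed (use readyD[OF s] in simp_all)
  then show "\<forall>v<m. rarr s' ''z'' v 0 = Y (o' + v) 0"
    "rarr s' ''be'' 0 0 = (\<Sum>v<m. b v * Y (o' + v) 0)" by blast+
qed

lemma flow_out_correct:
  assumes s: "ready s"
  defines "X \<equiv> rarr s ''X''" and "o' \<equiv> ivar s ''o''"
  shows "\<forall>e<n. rarr (sem flow_out s) ''x'' e 0 = (\<Sum>v<m. b v * X (o' + v) e)"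
proof -
  let ?I = "\<lambda>k u. \<forall>e<k. rarr u ''x'' e 0 = (\<Sum>v<m. b v * X (o' + v) e)"
  show ?thesis
    unfolding flow_out_def
  proof (rule sem_For[where I = ?I and K = n], goal_cases)
    case (4 k t)
    note k = 4(1,2) and fr = 4(3) and I = 4(4)
    have t: "ready t" by (rule ready_frame[OF s fr]) simp_all
    have f: "ivar t ''o'' = o'" "rarr t ''X'' = X"
      using ivar_frame[OF fr, of "''o''"] rarr_frame[OF fr, of "''X''"] by (simp_all add: o'_def X_def)
    let ?t = "sem (PR ''x'' (IVar ''e'') I0 (RConst 0)) t"
    let ?J = "\<lambda>i u. ?I k u \<and> rarr u ''x'' k 0 = (\<Sum>v<i. b v * X (o' + v) k)"
    have "?J m (sem add_flow ?t)"
      unfolding add_flow_def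
    proof (rule sem_For[where I = ?J and K = m], goal_cases)
      case 3
      then show ?case using I k by simp
    next
      case (4 i u)
      note i = 4(1,2) and fr = 4(3) and J = 4(4)
      have u: "ready u" by (rule ready_frame[OF _ fr]; (rule ready_cong[OF t])?) simp_all
      have "ivar u ''o'' = o'" "rarr u ''X'' = X" "ivar u ''e'' = k"
        using ivar_frame[OF fr, of "''o''"] rarr_frame[OF fr, of "''X''"] ivar_frame[OF fr, of "''e''"] f k
        by simp_all
      then show ?case using J i k readyD[OF u] by simp
    qed (use readyD[OF t] in simp_all)
    then show ?case by (auto simp: less_Suc_eq)
  qed (use readyD[OF s] in simp_all)
qed

lemma slack_correct:
  assumes s: "ready s" and j: "ivar s ''j'' = j" "j < n"
  defines "Y \<equiv> rarr s ''Y''" and "o' \<equiv> ivar s ''o''"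
  shows "rarr (sem slack s) ''D'' 0 0 = - (\<Sum>t<m. A $$ (t, j) * Y (o' + t) 0)"
    and "rarr (sem slack s) ''G'' 0 0 = (\<Sum>t<m. A $$ (t, j) * Y (o' + t) 1) - c j"
proof -
  let ?I = "\<lambda>k u. rarr u ''D'' 0 0 = - (\<Sum>t<k. A $$ (t, j) * Y (o' + t) 0) \<and>
    rarr u ''G'' 0 0 = (\<Sum>t<k. A $$ (t, j) * Y (o' + t) 1) - c j"
  have "?I m (sem slack s)"
    unfolding slack_def sem.simps(5)
  proof (rule sem_For[where I = ?I and K = m], goal_cases)
    case (4 k u)
    note k = 4(1,2) and fr = 4(3) and I = 4(4)
    have u: "ready u" by (rule ready_frame[OF _ fr]; (rule ready_cong[OF s])?) simp_all
    have "ivar u ''j'' = j" "ivar u ''o'' = o'" "rarr u ''Y'' = Y"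
      using ivar_frame[OF fr, of "''j''"] ivar_frame[OF fr, of "''o''"] rarr_frame[OF fr, of "''Y''"] j
      by (simp_all add: o'_def Y_def)
    then show ?case using I k j readyD[OF u] by simp
  qed (use readyD[OF s] j in simp_all)
  then show "rarr (sem slack s) ''D'' 0 0 = - (\<Sum>t<m. A $$ (t, j) * Y (o' + t) 0)"
    "rarr (sem slack s) ''G'' 0 0 = (\<Sum>t<m. A $$ (t, j) * Y (o' + t) 1) - c j" by blast+
qed

text \<open>In fractions: if K / d < G / D, then everything that is at most K / d is at most G / D.
  A candidate with \<open>D = 0\<close> never wins the comparison, since then
  \<open>G \<le> 0\<close>; the earlier \<open>D'\<close> may be zero, which is why the claim is
  stated by cross multiplication.\<close>

lemma fraction_update:
  fixes K d D G D' G' :: real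
  assumes "0 < d" "0 \<le> K" "K * D < G * d" "0 \<le> D" "D = 0 \<Longrightarrow> G \<le> 0"
  shows "0 < D" "0 \<le> G" "0 \<le> D' \<Longrightarrow> G' * d \<le> K * D' \<Longrightarrow> G' * D \<le> G * D'"
proof -
  have "0 \<le> K * D" using assms by simp
  with assms(3) have "0 < G * d" by linarith
  then have G: "0 < G" using assms(1) by (simp add: zero_less_mult_iff)
  then show "0 \<le> G" by simp
  show D: "0 < D" using G assms(4,5) by (cases "D = 0") auto
  assume D': "0 \<le> D'" "G' * d \<le> K * D'"
  have "G' * d * D \<le> K * D' * D" by (rule mult_right_mono) (use D D' in auto)
  also have "\<dots> = K * D * D'" by simp
  also have "\<dots> \<le> G * d * D'" by (rule mult_right_mono) (use assms D' in auto)
  finally have "d * (G' * D) \<le> d * (G * D')" by (simp add: mult_ac)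
  then show "G' * D \<le> G * D'" using assms(1) by simp
qed

text \<open>With a number \<omega> in the dual solution, the constraint of column \<open>j\<close>
  reads \<open>G j \<le> \<omega> * D j\<close>. The result says that \<omega> = K / d satisfies all
  of them.\<close>

lemma scale_correct:
  assumes s: "ready s"
  defines "s' \<equiv> sem scale s" and "Y \<equiv> rarr s ''Y''" and "o' \<equiv> ivar s ''o''"
  defines "D \<equiv> \<lambda>j. - (\<Sum>t<m. A $$ (t, j) * Y (o' + t) 0)"
    and "G \<equiv> \<lambda>j. (\<Sum>t<m. A $$ (t, j) * Y (o' + t) 1) - c j"
  assumes D: "\<And>j. j < n \<Longrightarrow> 0 \<le> D j" and G: "\<And>j. j < n \<Longrightarrow> D j = 0 \<Longrightarrow> G j \<le> 0"
  shows "0 < rarr s' ''d'' 0 0" "0 \<le> rarr s' ''K'' 0 0"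
    "\<forall>j<n. G j * rarr s' ''d'' 0 0 \<le> rarr s' ''K'' 0 0 * D j"
proof -
  let ?I = "\<lambda>k u. 0 < rarr u ''d'' 0 0 \<and> 0 \<le> rarr u ''K'' 0 0 \<and>
    (\<forall>j<k. G j * rarr u ''d'' 0 0 \<le> rarr u ''K'' 0 0 * D j)"
  have "?I n s'"
    unfolding s'_def scale_def sem.simps(5)
  proof (rule sem_For[where I = ?I and K = n], goal_cases)
    case (4 k t)
    note k = 4(1,2) and fr = 4(3) and I = 4(4)
    have t: "ready t" by (rule ready_frame[OF _ fr]; (rule ready_cong[OF s])?) simp_all
    have f: "ivar t ''o'' = o'" "rarr t ''Y'' = Y"
      using ivar_frame[OF fr, of "''o''"] rarr_frame[OF fr, of "''Y''"] by (simp_all add: o'_def Y_def)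
    have g: "rarr (sem slack t) ''D'' 0 0 = D k" "rarr (sem slack t) ''G'' 0 0 = G k"
      using slack_correct[OF t k(2,1)] f by (simp_all add: D_def G_def)
    have h: "rarr (sem slack t) ''d'' = rarr t ''d''" "rarr (sem slack t) ''K'' = rarr t ''K''"
      by (simp_all add: rarr_sem)
    show ?case
    proof (cases "rarr t ''K'' 0 0 * D k < G k * rarr t ''d'' 0 0")
      case True
      note up = fraction_update[OF conjunct1[OF I] conjunct1[OF conjunct2[OF I]] True D[OF k(1)] G[OF k(1)]]
      have "\<forall>j<k. G j * D k \<le> G k * D j"
        using up(3) I D k(1) by auto
      then show ?thesis using True g h up(1,2) by (simp add: less_Suc_eq)
    next
      case False
      then show ?thesis using g h I by (auto simp: less_Suc_eq)
    qed
  qed (use readyD[OF s] in simp_all)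
  then show "0 < rarr s' ''d'' 0 0" "0 \<le> rarr s' ''K'' 0 0"
    "\<forall>j<n. G j * rarr s' ''d'' 0 0 \<le> rarr s' ''K'' 0 0 * D j" by blast+
qed

lemma dual_out_correct:
  assumes s: "ready s"
  shows "\<forall>v<m. rarr (sem dual_out s) ''y'' v 0 = rarr s ''d'' 0 0 * rarr s ''Y'' (ivar s ''o'' + v) 1 +
    rarr s ''K'' 0 0 * rarr s ''Y'' (ivar s ''o'' + v) 0"
proof -
  let ?I = "\<lambda>k u. \<forall>v<k. rarr u ''y'' v 0 = rarr s ''d'' 0 0 * rarr s ''Y'' (ivar s ''o'' + v) 1 +
    rarr s ''K'' 0 0 * rarr s ''Y'' (ivar s ''o'' + v) 0"
  show ?thesis
    unfolding dual_out_def
  proof (rule sem_For[where I = ?I and K = m], goal_cases)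
    case (4 k u)
    note k = 4(1,2) and fr = 4(3) and I = 4(4)
    have "ivar u ''o'' = ivar s ''o''" "rarr u ''Y'' = rarr s ''Y''" "rarr u ''d'' = rarr s ''d''"
      "rarr u ''K'' = rarr s ''K''"
      using ivar_frame[OF fr, of "''o''"] rarr_frame[OF fr, of "''Y''"] rarr_frame[OF fr, of "''d''"]
        rarr_frame[OF fr, of "''K''"] by simp_all
    then show ?case using I k by (auto simp: less_Suc_eq)
  qed (use readyD[OF s] in simp_all)
qed

section \<open>Finding two rows whose difference is a ray\<close>

definition drops :: "(nat \<Rightarrow> nat \<Rightarrow> real) \<Rightarrow> nat \<Rightarrow> nat \<Rightarrow> bool" where
  "drops Y l v \<longleftrightarrow> lex_less (Y (l + v) 0) (Y (l + v) 1) (Y (l - Suc m + v) 0) (Y (l - Suc m + v) 1)"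

lemma bval_row_drops:
  "ready s \<Longrightarrow> bval (row_drops e v) s \<longleftrightarrow> drops (rarr s ''Y'') (ival e s) (ivar s v)"
  using readyD(3)[of s] by (simp add: row_drops_def drops_def)

lemma unstable_correct:
  assumes s: "ready s"
  defines "s' \<equiv> sem unstable s" and "Y \<equiv> rarr s ''Y''" and "o' \<equiv> ivar s ''o''"
  shows "if ivar s' ''f'' = 0 then \<forall>v<m. \<not> drops Y o' v else ivar s' ''u'' < m \<and> drops Y o' (ivar s' ''u'')"
proof -
  let ?I = "\<lambda>k u. if ivar u ''f'' = 0 then \<forall>v<k. \<not> drops Y o' v
    else ivar u ''u'' < m \<and> drops Y o' (ivar u ''u'')"
  show ?thesis
    unfolding s'_def unstable_def sem.simps(5)
  proof (rule sem_For[where I = ?I and K = m], goal_cases)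
    case (4 k u)
    note k = 4(1,2) and fr = 4(3) and I = 4(4)
    have u: "ready u" by (rule ready_frame[OF _ fr]; (rule ready_cong[OF s])?) simp_all
    have "ivar u ''o'' = o'" "rarr u ''Y'' = Y"
      using ivar_frame[OF fr, of "''o''"] rarr_frame[OF fr, of "''Y''"] by (simp_all add: o'_def Y_def)
    then show ?case using I k by (auto simp: less_Suc_eq bval_row_drops[OF u] split: if_splits)
  qed (use readyD[OF s] in simp_all)
qed

lemma next_vertex_correct:
  assumes s: "ready s" and q: "ivar s ''q'' = q" "q < n"
  defines "s' \<equiv> sem next_vertex s" and "Y \<equiv> rarr s ''Y''" and "l \<equiv> ivar s ''l''"
  assumes ex: "\<exists>t<m. A $$ (t, q) < 0 \<and> drops Y (l - Suc m) t"
  shows "ivar s' ''w'' < m \<and> A $$ (ivar s' ''w'', q) < 0 \<and> drops Y (l - Suc m) (ivar s' ''w'')"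
proof -
  let ?P = "\<lambda>t. t < m \<and> A $$ (t, q) < 0 \<and> drops Y (l - Suc m) t"
  let ?I = "\<lambda>k u. (\<exists>t<k. ?P t) \<longrightarrow> ?P (ivar u ''w'')"
  have "?I m s'"
    unfolding s'_def next_vertex_def
  proof (rule sem_For[where I = ?I and K = m], goal_cases)
    case (4 k u)
    note k = 4(1,2) and fr = 4(3) and I = 4(4)
    have u: "ready u" by (rule ready_frame[OF s fr]) simp_all
    have "ivar u ''l'' = l" "ivar u ''q'' = q" "rarr u ''Y'' = Y"
      using ivar_frame[OF fr, of "''l''"] ivar_frame[OF fr, of "''q''"] rarr_frame[OF fr, of "''Y''"] q
      by (simp_all add: l_def Y_def)
    then show ?case using I k q readyD[OF u] by (auto simp: less_Suc_eq bval_row_drops[OF u])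
  qed (use readyD[OF s] in simp_all)
  with ex show ?thesis by blast
qed

lemma descend_correct:
  assumes s: "ready s" and o': "ivar s ''o'' = Suc m * Suc m"
  defines "Y \<equiv> rarr s ''Y''" and "pol \<equiv> iarr s ''pol''" and "s' \<equiv> sem descend s"
  assumes V: "value_iteration A m n c (\<lambda>k h. Y (k * Suc m + h) 0) (\<lambda>k h. Y (k * Suc m + h) 1)
    X (\<lambda>k h. pol (k * Suc m + h))"
    and u: "ivar s ''u'' < m" "drops Y (Suc m * Suc m) (ivar s ''u'')"
  shows "value_iteration.chain A m (\<lambda>k h. pol (k * Suc m + h)) (iarr s' ''chv'')"
    and "\<forall>k\<le>m. value_iteration.strict (\<lambda>k h. Y (k * Suc m + h) 0) (\<lambda>k h. Y (k * Suc m + h) 1)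
      (m - k) (iarr s' ''chv'' k)"
    and "\<forall>k\<le>m. iarr s' ''chn'' k = (Suc m - k) * Suc m + iarr s' ''chv'' k"
proof -
  interpret value_iteration A m n c "\<lambda>k h. Y (k * Suc m + h) 0" "\<lambda>k h. Y (k * Suc m + h) 1"
    X "\<lambda>k h. pol (k * Suc m + h)" by (rule V)
  have drops_strict: "drops Y (Suc k * Suc m) h \<longleftrightarrow> strict k h" for k h
    unfolding drops_def strict_def by simp
  \<comment> \<open>The current vertex is still in register \<open>u\<close> and not yet in the
    array. Inserting it at position \<open>k\<close> lets the invariant treat it like the stored
    ones.\<close>
  let ?v = "\<lambda>k t. (iarr t ''chv'')(k := ivar t ''u'')"
  let ?I = "\<lambda>k t. ivar t ''l'' = (Suc m - k) * Suc m \<and>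
    (\<forall>i\<le>k. i \<le> m \<longrightarrow> ?v k t i < m \<and> strict (m - i) (?v k t i)) \<and>
    (\<forall>i<k. i < m \<longrightarrow> (\<exists>j. pol ((Suc m - i) * Suc m + ?v k t i) = Suc j \<and> A $$ (?v k t (Suc i), j) < 0)) \<and>
    (\<forall>i<k. iarr t ''chn'' i = (Suc m - i) * Suc m + ?v k t i)"
  have I: "?I (Suc m) s'"
    unfolding s'_def descend_def sem.simps(5)
  proof (rule sem_For[where I = ?I and K = "Suc m"], goal_cases)
    case 3
    show ?case using u o' drops_strict[of m] by simp
  next
    case (4 k t)
    note k = 4(1,2) and fr = 4(3) and I = 4(4)
    have t: "ready t" by (rule ready_frame[OF _ fr]; (rule ready_cong[OF s])?) simp_all
    have f: "iarr t ''pol'' = pol" "rarr t ''Y'' = Y"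
      using iarr_frame[OF fr, of "''pol''"] rarr_frame[OF fr, of "''Y''"] by (simp_all add: pol_def Y_def)
    define h where "h = ivar t ''u''"
    have h: "h < m" "strict (m - k) h" using I k by (auto simp: h_def)
    have l: "ivar t ''l'' = Suc (m - k) * Suc m" using I k by (simp add: Suc_diff_le)
    obtain j where j: "pol (Suc (m - k) * Suc m + h) = Suc j"
      using strict_move[OF h(2)] h(1) by auto
    have jn: "j < n" using move[OF _ _ j] h(1) by simp
    let ?t = "sem (PA ''chv'' (IVar ''k'') (IVar ''u'') ;;
      PA ''chn'' (IVar ''k'') (IPlus (IVar ''l'') (IVar ''u'')) ;;
      PI ''q'' (IMinus (IArr ''pol'' (IPlus (IVar ''l'') (IVar ''u''))) I1)) t"
    define w where "w = ivar (sem next_vertex ?t) ''w''"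
    have t': "ready ?t" by (rule ready_cong[OF t]) simp_all
    have q: "ivar ?t ''q'' = j" using f l j by (simp add: h_def)
    \<comment> \<open>Restricted to \<open>k < m\<close>, because the last pass starts on level 1
      and has no strict decrease below it to follow.\<close>
    have w: "w < m \<and> A $$ (w, j) < 0 \<and> strict (m - Suc k) w" if "k < m"
    proof -
      from that obtain i where i: "m - k = Suc i" "m - Suc k = i" by (metis Suc_diff_Suc)
      have "\<exists>t<m. A $$ (t, j) < 0 \<and> strict i t"
        by (rule strict_step[of i h j]) (use h i j in auto)
      then have "\<exists>t<m. A $$ (t, j) < 0 \<and> drops (rarr ?t ''Y'') (ivar ?t ''l'' - Suc m) t"
        using f l drops_strict[of i] i by simp
      from next_vertex_correct[OF t' q jn this] show ?thesis
        using f l drops_strict[of i] i by (simp add: w_def)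
    qed
    define t2 where "t2 = set_reg ''k'' (Suc k) (sem (PA ''chv'' (IVar ''k'') (IVar ''u'') ;;
      PA ''chn'' (IVar ''k'') (IPlus (IVar ''l'') (IVar ''u'')) ;;
      PI ''q'' (IMinus (IArr ''pol'' (IPlus (IVar ''l'') (IVar ''u''))) I1) ;;
      next_vertex ;; PI ''u'' (IVar ''w'') ;; PI ''l'' (IMinus (IVar ''l'') (IVar ''M''))) t)"
    have "ivar t2 ''u'' = w" "ivar t2 ''l'' = (m - k) * Suc m"
      "iarr t2 ''chv'' = (iarr t ''chv'')(k := h)"
      "iarr t2 ''chn'' = (iarr t ''chn'')(k := (Suc m - k) * Suc m + h)"
      using k l readyD[OF t] by (simp_all add: t2_def w_def h_def ivar_sem iarr_sem Suc_diff_le)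
    then have t2: "?v (Suc k) t2 = (?v k t)(Suc k := w)" "ivar t2 ''l'' = (m - k) * Suc m"
      "iarr t2 ''chn'' = (iarr t ''chn'')(k := (Suc m - k) * Suc m + h)"
      by (simp_all add: h_def)
    have "?I (Suc k) t2"
      unfolding t2(1,2,3)
    proof (intro conjI allI impI)
      fix i assume i: "i \<le> Suc k" "i \<le> m"
      then show "((?v k t)(Suc k := w)) i < m" "strict (m - i) (((?v k t)(Suc k := w)) i)"
        using I w by (cases "i = Suc k"; simp)+
    next
      fix i assume i: "i < Suc k" "i < m"
      show "\<exists>j. pol ((Suc m - i) * Suc m + ((?v k t)(Suc k := w)) i) = Suc j \<and>
          A $$ (((?v k t)(Suc k := w)) (Suc i), j) < 0"
      proof (cases "i = k")
        case True
        then show ?thesis using j w i by (auto simp: h_def Suc_diff_le)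
      next
        case False
        then have "i < k" using i by simp
        moreover from this have "\<exists>j. pol ((Suc m - i) * Suc m + ?v k t i) = Suc j \<and>
            A $$ (?v k t (Suc i), j) < 0" using I i by blast
        ultimately show ?thesis by simp
      qed
    next
      fix i assume i: "i < Suc k"
      show "((iarr t ''chn'')(k := (Suc m - k) * Suc m + h)) i =
          (Suc m - i) * Suc m + ((?v k t)(Suc k := w)) i"
      proof (cases "i = k")
        case True
        then show ?thesis by (simp add: h_def)
      next
        case False
        then have "i < k" using i by simp
        moreover from this have "iarr t ''chn'' i = (Suc m - i) * Suc m + ?v k t i" using I by blast
        ultimately show ?thesis by simp
      qed
    qed simp
    then show ?case unfolding t2_def sem.simps(5) .
  qed (use readyD[OF s] in simp_all)
  have v: "?v (Suc m) s' i = iarr s' ''chv'' i" if "i \<le> m" for i using that by simp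
  have 1: "iarr s' ''chv'' i < m \<and> strict (m - i) (iarr s' ''chv'' i)" if "i \<le> m" for i
  proof -
    have "?v (Suc m) s' i < m \<and> strict (m - i) (?v (Suc m) s' i)" using I that by simp
    then show ?thesis unfolding v[OF that] .
  qed
  have 2: "\<exists>j. pol ((Suc m - i) * Suc m + iarr s' ''chv'' i) = Suc j \<and> A $$ (iarr s' ''chv'' (Suc i), j) < 0"
    if "i < m" for i
  proof -
    have "\<exists>j. pol ((Suc m - i) * Suc m + ?v (Suc m) s' i) = Suc j \<and> A $$ (?v (Suc m) s' (Suc i), j) < 0"
      using I that by (meson less_SucI)
    then show ?thesis using v[of i] v[of "Suc i"] that by simp
  qed
  have 3: "iarr s' ''chn'' i = (Suc m - i) * Suc m + iarr s' ''chv'' i" if "i \<le> m" for i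
  proof -
    have "iarr s' ''chn'' i = (Suc m - i) * Suc m + ?v (Suc m) s' i"
      using I that by (meson le_imp_less_Suc)
    then show ?thesis unfolding v[OF that] .
  qed
  show "chain (iarr s' ''chv'')" unfolding chain_def using 1 2 by blast
  show "\<forall>k\<le>m. strict (m - k) (iarr s' ''chv'' k)" using 1 by blast
  show "\<forall>k\<le>m. iarr s' ''chn'' k = (Suc m - k) * Suc m + iarr s' ''chv'' k" using 3 by blast
qed

text \<open>Later pairs overwrite earlier ones. Any repetition will do, so the conclusion does not
  say which pair is left in the registers.\<close>

lemma repeated_correct:
  assumes s: "ready s"
  defines "v \<equiv> iarr s ''chv''" and "w \<equiv> iarr s ''chn''" and "s' \<equiv> sem repeated s"
  assumes ex: "i < j" "j \<le> m" "v i = v j"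
  shows "\<exists>i j. i < j \<and> j \<le> m \<and> v i = v j \<and> ivar s' ''p1'' = w i \<and> ivar s' ''p0'' = w j"
proof -
  let ?E = "\<lambda>i j. i < j \<and> j \<le> m \<and> v i = v j"
  let ?F = "\<lambda>u. \<exists>i j. ?E i j \<and> ivar u ''p1'' = w i \<and> ivar u ''p0'' = w j"
  let ?I = "\<lambda>k u. (\<exists>i<k. \<exists>j. ?E i j) \<longrightarrow> ?F u"
  have "?I (Suc m) s'"
    unfolding s'_def repeated_def
  proof (rule sem_For[where I = ?I and K = "Suc m"], goal_cases)
    case (4 k t)
    note k = 4(1,2) and fr = 4(3) and I = 4(4)
    have t: "ready t" by (rule ready_frame[OF s fr]) simp_all
    have f: "iarr t ''chv'' = v" "iarr t ''chn'' = w"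
      using iarr_frame[OF fr, of "''chv''"] iarr_frame[OF fr, of "''chn''"] by (simp_all add: v_def w_def)
    let ?J = "\<lambda>l u. (\<exists>i<k. \<exists>j. ?E i j) \<or> (\<exists>j<l. ?E k j) \<longrightarrow> ?F u"
    have "?J (Suc m) (sem repeated_later t)"
      unfolding repeated_later_def
    proof (rule sem_For[where I = ?J and K = "Suc m"], goal_cases)
      case 3
      show ?case using I by simp
    next
      case (4 l u)
      note l = 4(1,2) and fr = 4(3) and J = 4(4)
      have g: "iarr u ''chv'' = v" "iarr u ''chn'' = w" "ivar u ''i'' = k"
        using iarr_frame[OF fr, of "''chv''"] iarr_frame[OF fr, of "''chn''"] ivar_frame[OF fr, of "''i''"] f k
        by simp_all
      show ?case
      proof (cases "?E k l")
        case True
        then have "\<exists>i j. ?E i j \<and> w k = w i \<and> w l = w j" by blast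
        then show ?thesis using True g l by simp
      next
        case False
        then show ?thesis using J g l by (auto simp: less_Suc_eq)
      qed
    qed (use readyD[OF t] in simp_all)
    then show ?case by (auto simp: less_Suc_eq_le le_less)
  qed (use readyD[OF s] in simp_all)
  moreover have "i < Suc m" using ex by simp
  ultimately show ?thesis using ex by blast
qed

lemma ray_out_correct:
  assumes s: "ready s"
  shows "\<forall>e<n. rarr (sem ray_out s) ''r'' e 0 = rarr s ''X'' (ivar s ''p1'') e - rarr s ''X'' (ivar s ''p0'') e"
proof -
  let ?I = "\<lambda>k u. \<forall>e<k. rarr u ''r'' e 0 = rarr s ''X'' (ivar s ''p1'') e - rarr s ''X'' (ivar s ''p0'') e"
  show ?thesis
    unfolding ray_out_def
  proof (rule sem_For[where I = ?I and K = n], goal_cases)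
    case (4 k u)
    note k = 4(1,2) and fr = 4(3) and I = 4(4)
    have "ivar u ''p1'' = ivar s ''p1''" "ivar u ''p0'' = ivar s ''p0''" "rarr u ''X'' = rarr s ''X''"
      using ivar_frame[OF fr, of "''p1''"] ivar_frame[OF fr, of "''p0''"] rarr_frame[OF fr, of "''X''"]
      by simp_all
    then show ?case using I k by (auto simp: less_Suc_eq)
  qed (use readyD[OF s] in simp_all)
qed

end


section \<open>Certificates expressed by sums\<close>

lemma mult_mat_vec_sum:
  "A \<in> carrier_mat m n \<Longrightarrow> i < m \<Longrightarrow> (A *\<^sub>v vec n x) $ i = (\<Sum>e<n. A $$ (i, e) * x e)"
  by (simp add: scalar_prod_def atLeast0LessThan)

lemma transpose_mult_vec_sum:
  "A \<in> carrier_mat m n \<Longrightarrow> j < n \<Longrightarrow> (A\<^sup>T *\<^sub>v vec m y) $ j = (\<Sum>i<m. A $$ (i, j) * y i)"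
  by (simp add: scalar_prod_def atLeast0LessThan)

lemma scalar_prod_vec_sum: "vec n x \<bullet> vec n y = (\<Sum>i<n. x i * y i)"
  by (simp add: scalar_prod_def atLeast0LessThan)

lemma primal_feasibleI:
  assumes "A \<in> carrier_mat m n" "\<forall>e<n. 0 \<le> x e" "\<forall>u<m. (\<Sum>e<n. A $$ (u, e) * x e) = b u"
  shows "primal_feasible A (vec m b) (vec n x)"
  using assms mult_mat_vec_sum[OF assms(1)]
  by (auto simp: primal_feasible_def less_eq_vec_def simp del: index_mult_mat_vec)

lemma dual_feasibleI:
  assumes "A \<in> carrier_mat m n" "\<forall>j<n. (\<Sum>i<m. A $$ (i, j) * y i) \<le> c j"
  shows "dual_feasible A (vec n c) (vec m y)"
  using assms transpose_mult_vec_sum[OF assms(1)]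
  by (auto simp: dual_feasible_def less_eq_vec_def simp del: index_mult_mat_vec)

lemma primal_farkasI:
  assumes "A \<in> carrier_mat m n" "\<forall>j<n. (\<Sum>i<m. A $$ (i, j) * z i) \<le> 0" "0 < (\<Sum>i<m. z i * b i)"
  shows "primal_farkas A (vec m b) (vec m z)"
  using assms transpose_mult_vec_sum[OF assms(1)]
  by (auto simp: primal_farkas_def less_eq_vec_def scalar_prod_vec_sum simp del: index_mult_mat_vec)

lemma dual_farkasI:
  assumes "A \<in> carrier_mat m n" "\<forall>e<n. 0 \<le> r e" "\<forall>u<m. (\<Sum>e<n. A $$ (u, e) * r e) = 0"
    "(\<Sum>e<n. c e * r e) < 0"
  shows "dual_farkas A (vec n c) (vec n r)"
  using assms mult_mat_vec_sum[OF assms(1)]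
  by (auto simp: dual_farkas_def less_eq_vec_def scalar_prod_vec_sum simp del: index_mult_mat_vec)

lemma stored_vec_cong: "(\<And>i. i < k \<Longrightarrow> rarr s a i 0 = x i) \<Longrightarrow> stored_vec s a k = vec k x"
  by (auto simp: stored_vec_def)

context lp_input
begin

text \<open>Two independent tests select the case: the sign of \<open>\<beta>\<close> decides
  between a primal solution and a primal Farkas certificate, the flag \<open>f\<close> between a
  dual solution and a ray.\<close>

lemma leontief_lp_correct:
  assumes s: "ready s" and b: "\<And>v. v < m \<Longrightarrow> 0 \<le> b v" and o': "ivar s ''o'' = 0"
    and Y0: "rarr s ''Y'' = (\<lambda>_ _. 0)" and X0: "rarr s ''X'' = (\<lambda>_ _. 0)"
  defines "s' \<equiv> sem leontief_lp s"
  shows "\<exists>cert. outputs m n s' cert \<and> valid_certificate A (vec m b) (vec n c) cert"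
proof -
  define s1 where "s1 = sem heads s"
  define s2 where "s2 = sem start s1"
  define s3 where "s3 = sem iteration s2"
  define s4 where "s4 = sem farkas_out s3"
  define s5 where "s5 = sem flow_out s4"
  define s6 where "s6 = sem scale s5"
  define s7 where "s7 = sem dual_out s6"
  define s8 where "s8 = sem unstable s7"
  define s9 where "s9 = sem descend s8"
  define s10 where "s10 = sem repeated s9"
  define s11 where "s11 = sem root_check s10"
  define s12 where "s12 = sem ray_out s11"
  have s': "s' = sem verdict s12"
    by (simp add: s'_def leontief_lp_def s1_def s2_def s3_def s4_def s5_def s6_def s7_def s8_def
        s9_def s10_def s11_def s12_def)
  have r1: "ready s1" unfolding s1_def by (rule ready_frame[OF s frame_sem]) simp_all
  have r2: "ready s2" unfolding s2_def by (rule ready_frame[OF r1 frame_sem]) simp_all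
  have r3: "ready s3" unfolding s3_def by (rule ready_frame[OF r2 frame_sem]) simp_all
  have r4: "ready s4" unfolding s4_def by (rule ready_frame[OF r3 frame_sem]) simp_all
  have r5: "ready s5" unfolding s5_def by (rule ready_frame[OF r4 frame_sem]) simp_all
  have r6: "ready s6" unfolding s6_def by (rule ready_frame[OF r5 frame_sem]) simp_all
  have r7: "ready s7" unfolding s7_def by (rule ready_frame[OF r6 frame_sem]) simp_all
  have r8: "ready s8" unfolding s8_def by (rule ready_frame[OF r7 frame_sem]) simp_all
  have r9: "ready s9" unfolding s9_def by (rule ready_frame[OF r8 frame_sem]) simp_all
  have r10: "ready s10" unfolding s10_def by (rule ready_frame[OF r9 frame_sem]) simp_all
  have r11: "ready s11" unfolding s11_def by (rule ready_frame[OF r10 frame_sem]) simp_all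
  define Y where "Y = rarr s3 ''Y''"
  define X where "X = rarr s3 ''X''"
  define pol where "pol = iarr s3 ''pol''"
  let ?top = "Suc m * Suc m"
  have hd: "\<forall>j<n. iarr s2 ''hd'' j = col_head j"
    using heads_correct[OF s] by (simp add: s2_def s1_def iarr_sem)
  have o2: "ivar s2 ''o'' = 0" using o' by (simp add: s2_def s1_def ivar_sem)
  note it = iteration_correct[OF r2 hd o2, folded s3_def]
  have Y2: "rarr s2 ''Y'' i j = (if i < m \<and> j = 0 then 1 else 0)" for i j
    using start_correct[OF r1] Y0 by (simp add: s2_def s1_def rarr_sem)
  have X2: "rarr s2 ''X'' = (\<lambda>_ _. 0)" using X0 by (simp add: s2_def s1_def rarr_sem)
  have VI: "value_iteration A m n c (\<lambda>k h. Y (k * Suc m + h) 0) (\<lambda>k h. Y (k * Suc m + h) 1)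
      (\<lambda>k h. X (k * Suc m + h)) (\<lambda>k h. pol (k * Suc m + h))"
  proof (rule value_iteration_levels)
    fix h assume "h \<le> m"
    then have "Y h = rarr s2 ''Y'' h" "X h = rarr s2 ''X'' h"
      using it(2) by (simp_all add: rows_agree_def Y_def X_def)
    then show "Y h 0 = (if h < m then 1 else 0)" "Y h 1 = 0" "X h e = 0" for e
      using Y2 X2 by simp_all
  next
    fix k h assume "k \<le> m" "h \<le> m"
    then show "relaxed Y X pol (k * Suc m) h"
      using it(1) by (simp add: level_done_def Y_def X_def pol_def)
  qed
  interpret value_iteration A m n c "\<lambda>k h. Y (k * Suc m + h) 0" "\<lambda>k h. Y (k * Suc m + h) 1"
    "\<lambda>k h. X (k * Suc m + h)" "\<lambda>k h. pol (k * Suc m + h)" by (rule VI)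
  have o3: "ivar s3 ''o'' = ?top" using it(3) .
  have os: "ivar s4 ''o'' = ?top" "ivar s5 ''o'' = ?top" "ivar s6 ''o'' = ?top" "ivar s7 ''o'' = ?top"
    "ivar s8 ''o'' = ?top" "ivar s10 ''o'' = ?top"
    using o3 by (simp_all add: s4_def s5_def s6_def s7_def s8_def s9_def s10_def ivar_sem)
  have Ys: "rarr s5 ''Y'' = Y" "rarr s6 ''Y'' = Y" "rarr s7 ''Y'' = Y" "rarr s8 ''Y'' = Y"
    "rarr s10 ''Y'' = Y"
    by (simp_all add: Y_def s4_def s5_def s6_def s7_def s8_def s9_def s10_def rarr_sem)
  have Xs: "rarr s4 ''X'' = X" "rarr s11 ''X'' = X"
    by (simp_all add: X_def s4_def s5_def s6_def s7_def s8_def s9_def s10_def s11_def rarr_sem)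
  have pol8: "iarr s8 ''pol'' = pol"
    by (simp add: pol_def s4_def s5_def s6_def s7_def s8_def iarr_sem)

  define z where "z v = Y (?top + v) 0" for v
  define a where "a v = Y (?top + v) 1" for v
  define \<beta> where "\<beta> = (\<Sum>v<m. b v * z v)"
  define x where "x e = (\<Sum>v<m. b v * X (?top + v) e)" for e
  define d where "d = rarr s6 ''d'' 0 0"
  define K where "K = rarr s6 ''K'' 0 0"
  define f where "f = ivar s11 ''f''"
  have z': "stored_vec s' ''z'' m = vec m z"
    by (rule stored_vec_cong)
       (use farkas_out_correct(1)[OF r3] o3 in \<open>simp add: s' s12_def s11_def s10_def s9_def s8_def
          s7_def s6_def s5_def s4_def rarr_sem z_def Y_def\<close>)
  have be: "rarr s12 ''be'' 0 0 = \<beta>"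
    using farkas_out_correct(2)[OF r3] o3
    by (simp add: s12_def s11_def s10_def s9_def s8_def
          s7_def s6_def s5_def s4_def rarr_sem \<beta>_def z_def Y_def)
  have x': "stored_vec s' ''x'' n = vec n x"
    by (rule stored_vec_cong)
       (use flow_out_correct[OF r4] os Xs in \<open>simp add: s' s12_def s11_def s10_def s9_def s8_def
          s7_def s6_def s5_def rarr_sem x_def\<close>)
  have d': "rarr s' ''d'' 0 0 = d"
    by (simp add: s' s12_def s11_def s10_def s9_def s8_def s7_def rarr_sem d_def)
  have y': "stored_vec s' ''y'' m = vec m (\<lambda>v. d * a v + K * z v)"
    by (rule stored_vec_cong)
       (use dual_out_correct[OF r6] os Ys in \<open>simp add: s' s12_def s11_def s10_def s9_def s8_def
          s7_def rarr_sem a_def z_def d_def K_def\<close>)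
  have f': "ivar s12 ''f'' = f" by (simp add: s12_def f_def ivar_sem)
  have case': "ivar s' ''case'' = (if 0 < \<beta> then if 0 < f then 4 else 2 else if 0 < f then 3 else 1)"
    using be f' by (simp add: s' verdict_def)

  have z_nonneg: "0 \<le> z v" if "v < m" for v
    using B_nonneg[of "Suc m" v] that by (simp add: z_def)
  have \<beta>_nonneg: "0 \<le> \<beta>"
    unfolding \<beta>_def by (intro sum_nonneg mult_nonneg_nonneg b z_nonneg) auto
  have z_dual: "\<forall>j<n. (\<Sum>i<m. A $$ (i, j) * z i) \<le> 0" using B_farkas by (simp add: z_def)
  have infeasible: "primal_farkas A (vec m b) (stored_vec s' ''z'' m)" if "0 < \<beta>"
    unfolding z' by (rule primal_farkasI[OF carrier z_dual]) (use that in \<open>simp add: \<beta>_def mult.commute\<close>)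
  have feasible: "primal_feasible A (vec m b) (stored_vec s' ''x'' n)"
    and cost: "(\<Sum>e<n. c e * x e) = (\<Sum>v<m. b v * a v)" if "\<not> 0 < \<beta>"
  proof -
    have "\<beta> = 0" using that \<beta>_nonneg by simp
    then have B0: "(\<Sum>v<m. b v * Y (Suc m * Suc m + v) 0) = 0" by (simp add: \<beta>_def z_def)
    note ff = flow_feasible[of b, OF b B0]
    show "primal_feasible A (vec m b) (stored_vec s' ''x'' n)"
      unfolding x' by (rule primal_feasibleI[OF carrier]) (use ff(1,2) in \<open>simp_all add: x_def\<close>)
    show "(\<Sum>e<n. c e * x e) = (\<Sum>v<m. b v * a v)" using ff(3) by (simp add: x_def a_def)
  qed

  have drops_strict: "drops Y ?top v \<longleftrightarrow> strict m v" for v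
    unfolding drops_def strict_def by simp
  have st: "if ivar s8 ''f'' = 0 then \<forall>v<m. \<not> strict m v else ivar s8 ''u'' < m \<and> strict m (ivar s8 ''u'')"
    using unstable_correct[OF r7, folded s8_def] unfolding os Ys drops_strict .
  have f10: "ivar s10 ''f'' = ivar s8 ''f''" by (simp add: s10_def s9_def ivar_sem)
  have root: "bval (RLess (RArr ''Y'' (IPlus (IVar ''o'') (IVar ''m'')) I1) (RConst 0)) s10 \<longleftrightarrow> a m < 0"
    using os Ys readyD[OF r10] by (simp add: a_def)

  have unbounded: "dual_farkas A (vec n c) (stored_vec s' ''r'' n)" if "0 < f"
  proof -
    define r where "r e = X (ivar s11 ''p1'') e - X (ivar s11 ''p0'') e" for e
    have r': "stored_vec s' ''r'' n = vec n r"
      by (rule stored_vec_cong)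
         (use ray_out_correct[OF r11] Xs in \<open>simp add: s' s12_def rarr_sem r_def\<close>)
    \<comment> \<open>The flag is raised by a negative root value or by a strict decrease at a row.
      The case distinction follows \<open>root_check\<close>, which gives precedence to the
      root.\<close>
    have "(\<forall>e<n. 0 \<le> r e) \<and> (\<forall>u<m. (\<Sum>e<n. A $$ (u, e) * r e) = 0) \<and> (\<Sum>e<n. c e * r e) < 0"
    proof (cases "a m < 0")
      case True
      then have "ivar s11 ''p1'' = ?top + m" "ivar s11 ''p0'' = m"
        using root os readyD[OF r10] by (simp_all add: s11_def root_check_def del: bval.simps)
      moreover have "X m e = 0" if "e < n" for e using X_0[of m e] that by simp
      ultimately have r: "r e = X (Suc m * Suc m + m) e" if "e < n" for e
        using that by (simp add: r_def)
      have "Y (Suc m * Suc m + m) 1 < 0" using True by (simp add: a_def)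
      from root_ray[OF this] r show ?thesis by simp
    next
      case False
      then have s11: "s11 = s10" using root by (simp add: s11_def root_check_def del: bval.simps)
      then have u: "ivar s8 ''u'' < m" "drops Y ?top (ivar s8 ''u'')"
        using that st f10 drops_strict by (auto simp: f_def split: if_splits)
      have VI8: "value_iteration A m n c (\<lambda>k h. rarr s8 ''Y'' (k * Suc m + h) 0)
          (\<lambda>k h. rarr s8 ''Y'' (k * Suc m + h) 1)
          (\<lambda>k h. X (k * Suc m + h)) (\<lambda>k h. iarr s8 ''pol'' (k * Suc m + h))"
        unfolding Ys pol8 by (rule VI)
      have u8: "drops (rarr s8 ''Y'') (Suc m * Suc m) (ivar s8 ''u'')" unfolding Ys by (rule u)
      note ds = descend_correct[OF r8 os(5) VI8 u(1) u8, unfolded Ys pol8, folded s9_def]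
      let ?v = "iarr s9 ''chv''"
      obtain i j where "i < j" "j \<le> m" "?v i = ?v j" using chain_repeats[OF ds(1)] by blast
      from repeated_correct[OF r9 this, folded s10_def] obtain i j where
        ij: "i < j" "j \<le> m" "?v i = ?v j" and
        p: "ivar s10 ''p1'' = iarr s9 ''chn'' i" "ivar s10 ''p0'' = iarr s9 ''chn'' j" by blast
      have r: "r = (\<lambda>e. X ((Suc m - i) * Suc m + ?v i) e - X ((Suc m - j) * Suc m + ?v j) e)"
        using ds(3) ij p s11 by (simp add: r_def fun_eq_iff)
      have "i \<le> m" using ij by simp
      from chain_ray[OF ds(1) ij ds(2)[rule_format, OF this]] show ?thesis unfolding r by blast
    qed
    then show ?thesis unfolding r' by (intro dual_farkasI[OF carrier]) auto
  qed

  \<comment> \<open>The value of the last level with K / d in place of \<omega>; multiplied by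
    \<open>d\<close> it is the vector stored by \<open>dual_out\<close>.\<close>
  define y where "y v = a v + K / d * z v" for v
  have dual: "0 < d" "(1 / d) \<cdot>\<^sub>v stored_vec s' ''y'' m = vec m y" "dual_feasible A (vec n c) (vec m y)"
    if "\<not> 0 < f"
  proof -
    have am: "0 \<le> a m" using that root by (auto simp: f_def s11_def root_check_def simp del: bval.simps)
    then have "s11 = s10" using root by (simp add: s11_def root_check_def del: bval.simps)
    then have stable: "\<not> strict m v" if "v < m" for v
      using \<open>\<not> 0 < f\<close> that st f10 by (simp add: f_def)
    have dual_ineq: "(\<Sum>i<m. A $$ (i, j) * a i) \<le> c j"
      if "j < n" "(\<Sum>i<m. A $$ (i, j) * z i) = 0" for j
      using stable_dual[OF _ stable that(1)] am that(2) by (simp add: a_def z_def)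
    have D: "0 \<le> - (\<Sum>i<m. A $$ (i, j) * z i)" if "j < n" for j using z_dual that by simp
    have G: "(\<Sum>i<m. A $$ (i, j) * a i) - c j \<le> 0"
      if "j < n" "- (\<Sum>i<m. A $$ (i, j) * z i) = 0" for j
      using dual_ineq[OF that(1)] that(2) by simp
    note sc = scale_correct[OF r5, folded s6_def, folded d_def K_def, unfolded Ys os, folded z_def a_def, OF D G]
    show d: "0 < d" by (rule sc(1))
    show "(1 / d) \<cdot>\<^sub>v stored_vec s' ''y'' m = vec m y"
      unfolding y' by (rule eq_vecI) (use d in \<open>auto simp: y_def field_simps\<close>)
    show "dual_feasible A (vec n c) (vec m y)"
    proof (rule dual_feasibleI[OF carrier], intro allI impI)
      fix j assume j: "j < n"
      have "(\<Sum>i<m. A $$ (i, j) * y i) = (\<Sum>i<m. A $$ (i, j) * a i) + K / d * (\<Sum>i<m. A $$ (i, j) * z i)"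
        by (simp add: y_def distrib_left sum.distrib sum_distrib_left mult.left_commute)
      moreover have "(\<Sum>i<m. A $$ (i, j) * a i) - c j \<le> K / d * - (\<Sum>i<m. A $$ (i, j) * z i)"
      proof -
        have "((\<Sum>i<m. A $$ (i, j) * a i) - c j) * d \<le> - (K * (\<Sum>i<m. A $$ (i, j) * z i))"
          using sc(3) j by simp
        then have "(\<Sum>i<m. A $$ (i, j) * a i) - c j \<le> - (K * (\<Sum>i<m. A $$ (i, j) * z i)) / d"
          by (simp only: pos_le_divide_eq[OF d])
        then show ?thesis by simp
      qed
      ultimately show "(\<Sum>i<m. A $$ (i, j) * y i) \<le> c j" by simp
    qed
  qed
  \<comment> \<open>For \<open>\<beta> = 0\<close> the number substituted for \<omega> drops out of
    the dual objective, and what remains is the cost of the flow.\<close>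
  have optimal: "vec n c \<bullet> vec n x = vec m y \<bullet> vec m b" if "\<not> 0 < \<beta>"
  proof -
    have "\<beta> = 0" using that \<beta>_nonneg by simp
    have "(\<Sum>v<m. y v * b v) = (\<Sum>v<m. b v * a v + K / d * (b v * z v))"
      by (rule sum.cong) (auto simp: y_def algebra_simps)
    also have "\<dots> = (\<Sum>v<m. b v * a v) + K / d * \<beta>"
      by (simp only: \<beta>_def sum.distrib sum_distrib_left)
    finally have "(\<Sum>v<m. y v * b v) = (\<Sum>v<m. b v * a v) + K / d * \<beta>" .
    then show ?thesis using \<open>\<beta> = 0\<close> cost[OF that] by (simp add: scalar_prod_vec_sum)
  qed

  consider "0 < \<beta>" "0 < f" | "0 < \<beta>" "\<not> 0 < f" | "\<not> 0 < \<beta>" "0 < f" | "\<not> 0 < \<beta>" "\<not> 0 < f" by blast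
  then show ?thesis
  proof cases
    case 1
    then show ?thesis using infeasible unbounded case'
      by (intro exI[of _ "Both_Infeasible (stored_vec s' ''z'' m) (stored_vec s' ''r'' n)"]) simp
  next
    case 2
    then show ?thesis using infeasible dual case' d'
      by (intro exI[of _ "Primal_Infeasible (stored_vec s' ''z'' m) (vec m y)"]) simp
  next
    case 3
    then show ?thesis using feasible unbounded case'
      by (intro exI[of _ "Dual_Infeasible (stored_vec s' ''x'' n) (stored_vec s' ''r'' n)"]) simp
  next
    case 4
    then show ?thesis using feasible dual case' d' optimal x'
      by (intro exI[of _ "Optimal (stored_vec s' ''x'' n) (vec m y)"]) simp
  qed
qed

end

theorem theorem3p1:
  shows "\<exists>p :: com. \<exists>C :: nat. \<forall>(m :: nat) (n :: nat) (A :: real mat) (b :: real vec) (c :: real vec).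
    m \<ge> 1 \<longrightarrow> n \<ge> 1 \<longrightarrow>
    A \<in> carrier_mat m n \<longrightarrow> b \<in> carrier_vec m \<longrightarrow> c \<in> carrier_vec n \<longrightarrow>
    leontief A \<longrightarrow> gainfree A \<longrightarrow> 0\<^sub>v m \<le> b \<longrightarrow>
    (\<exists>t s cert. exec p (input_state A b c) t s \<and> t \<le> C * (m ^ 3 * n) \<and>
       outputs m n s cert \<and> valid_certificate A b c cert)"
proof -
  obtain C where C: "\<And>m n. m \<ge> 1 \<Longrightarrow> n \<ge> 1 \<Longrightarrow> time leontief_lp (sizes m n) \<le> C * (m ^ 3 * n)"
    using leontief_lp_time unfolding runs_in_def by auto
  \<comment> \<open>The assignment to \<open>M\<close> stays outside the compiled program, which
    must not write its own loop bounds.\<close>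
  let ?p = "Seq (IAssign ''M'' (IPlus (IVar ''m'') (IConst 1))) (compile leontief_lp)"
  show ?thesis
  \<comment> \<open>The additional 5 units pay for this assignment (4) and for the sequencing
    (1).\<close>
  proof (rule exI[of _ ?p], rule exI[of _ "C + 5"], intro allI impI)
    fix m n :: nat and A :: "real mat" and b c :: "real vec"
    assume mn: "m \<ge> 1" "n \<ge> 1" and A: "A \<in> carrier_mat m n" and b: "b \<in> carrier_vec m"
      and c: "c \<in> carrier_vec n" and L: "leontief A" "gainfree A" and b0: "0\<^sub>v m \<le> b"
    interpret lp_input A m n "\<lambda>i. b $ i" "\<lambda>j. c $ j"
      by unfold_locales (use A L in auto)
    let ?s = "set_reg ''M'' (Suc m) (input_state A b c)"
    let ?s' = "sem leontief_lp ?s"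
    have e: "exec (IAssign ''M'' (IPlus (IVar ''m'') (IConst 1))) (input_state A b c) 4 ?s"
      using exec.IAssign[of "''M''" "IPlus (IVar ''m'') (IConst 1)" "input_state A b c"] A
      by (simp add: set_reg_def input_state_def numeral_eq_Suc)
    have "ivar ?s v = sizes m n v" for v
      using A by (simp add: input_state_def sizes_def)
    then obtain t where t: "t \<le> time leontief_lp (sizes m n)" "exec (compile leontief_lp) ?s t ?s'"
      using exec_compile[OF leontief_lp_wf(1,3,2), of ?s "sizes m n"] by blast
    have ex: "exec ?p (input_state A b c) (1 + 4 + t) ?s'" by (rule exec.Seq[OF e t(2)])
    have "1 \<le> m ^ 3 * n" using mn by simp
    then have time: "1 + 4 + t \<le> (C + 5) * (m ^ 3 * n)"
      using C[OF mn] t(1) unfolding add_mult_distrib by linarith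
    have "ready ?s" using A b c by (auto simp: ready_def input_state_def)
    moreover have "0 \<le> b $ v" if "v < m" for v using b0 b that by (auto simp: less_eq_vec_def)
    ultimately have "\<exists>cert. outputs m n ?s' cert \<and>
        valid_certificate A (vec m (\<lambda>i. b $ i)) (vec n (\<lambda>j. c $ j)) cert"
      by (rule leontief_lp_correct) (simp_all add: input_state_def fun_eq_iff)
    moreover have "vec m (\<lambda>i. b $ i) = b" "vec n (\<lambda>j. c $ j) = c" using b c by auto
    ultimately show "\<exists>t s cert. exec ?p (input_state A b c) t s \<and> t \<le> (C + 5) * (m ^ 3 * n) \<and>
        outputs m n s cert \<and> valid_certificate A b c cert"
      using ex time by auto
  qed
qed

end
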